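(* Let $\mu,\beta\in\mathbf{R}$ and $\sigma>0$ be constants, let $Z\sim \mathrm{N}(0,1)$, and let $X$ be a random variable independent of $Z$ with a density $g$ supported on $(0,\infty)$. Let $Y=\mu+\beta X+\sigma\sqrt{X}\,Z$, and let $f$ denote the density of $Y$ on $\mathbf{R}$. Then: (i) If $g$ is unimodal, then so is $f$. (ii) If $g$ decreases on $(0,\infty)$, or $\beta=0$, then the only mode of $f$ is at $\mu$. (iii) If $g$ is log-concave, then so is $f$. (iv) If $g$ is log-convex on $(0,\infty)$, then $f$ is log-convex on each of the intervals $(-\infty,\mu)$ and $(\mu,\infty)$.
   Context: The density of $Y$ is taken to be the function $f(y)=\int_0^\infty \frac{1}{\sigma\sqrt{2\pi x}}\exp\left[-\frac{(y-\mu-\beta x)^2}{2\sigma^2 x}\right] g(x)\,dx$, $y\in\mathbf{R}$; the value $f(\mu)=+\infty$ is allowed (it can occur at $y=\mu$ if $g$ is large near $0$). "Increases" and "decreases" are meant in the non-strict sense. A function $f$ on $\mathbf{R}$ is unimodal if there exists $x_*\in\mathbf{R}$ such that $f$ increases on $(-\infty,x_*]$ and decreases on $[x_*,\infty)$; such a point $x_*$ is called a mode of $f$. For the density $g$ supported on $(0,\infty)$, unimodality means unimodality on the interval $(0,\infty)$: there is $x_*\in[0,\infty)$ such that $g$ increases on $(0,x_*]$ and decreases on $[x_*,\infty)\cap(0,\infty)$ (in particular a $g$ that decreases on $(0,\infty)$ is unimodal). A nonnegative function $f$ on $\mathbf{R}$ is log-concave if $f(\theta x+(1-\theta)y)\ge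 [f(x)]^\theta[f(y)]^{1-\theta}$ for all $x,y\in\mathbf{R}$, $\theta\in(0,1)$ (the density $g$ is regarded as zero on $(-\infty,0]$; equivalently the inequality is required for $x,y\in(0,\infty)$). A positive function $f$ on an interval $I$ is log-convex on $I$ if $\log f$ is convex on $I$. *)

theory Defs
  imports "HOL-Probability.Probability"
begin

definition is_mode :: "(real \<Rightarrow> 'a::linorder) \<Rightarrow> real \<Rightarrow> bool" where
  "is_mode f m \<longleftrightarrow> mono_on {..m} f \<and> antimono_on {m..} f"

definition unimodal :: "(real \<Rightarrow> 'a::linorder) \<Rightarrow> bool" where
  "unimodal f \<longleftrightarrow> (\<exists>m. is_mode f m)"

(* For m = 0 the first interval is empty: functions decreasing on all of {0<..} are included. *)
definition unimodal_pos :: "(real \<Rightarrow> 'a::linorder) \<Rightarrow> bool" where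
  "unimodal_pos g \<longleftrightarrow> (\<exists>m\<ge>0. mono_on {0<..m} g \<and> antimono_on ({m..} \<inter> {0<..}) g)"

(* Densities take values in [0,\<infinity>].  The power is only used for exponents t > 0, where
   \<infinity> to the power t is \<infinity> and 0 to the power t is 0. *)
definition ennreal_powr :: "ennreal \<Rightarrow> real \<Rightarrow> ennreal" where
  "ennreal_powr a t = (if a = \<infinity> then \<infinity> else ennreal (enn2real a powr t))"

definition logconcave :: "(real \<Rightarrow> ennreal) \<Rightarrow> bool" where
  "logconcave f \<longleftrightarrow> (\<forall>x y. \<forall>\<theta>\<in>{0<..<1}.
     ennreal_powr (f x) \<theta> * ennreal_powr (f y) (1 - \<theta>) \<le> f (\<theta> * x + (1 - \<theta>) * y))"

(* Finiteness and positivity on I are part of the definition, so that ln (f x) is meaningful. *)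
definition logconvex_on :: "real set \<Rightarrow> (real \<Rightarrow> ennreal) \<Rightarrow> bool" where
  "logconvex_on I f \<longleftrightarrow>
     (\<forall>x\<in>I. 0 < f x \<and> f x < \<infinity>) \<and> convex_on I (\<lambda>x. ln (enn2real (f x)))"

definition mixture_density :: "real \<Rightarrow> real \<Rightarrow> real \<Rightarrow> (real \<Rightarrow> real) \<Rightarrow> real \<Rightarrow> ennreal" where
  "mixture_density \<mu> \<beta> \<sigma> g y =
     (\<integral>\<^sup>+x\<in>{0<..}. ennreal (1 / (\<sigma> * sqrt (2 * pi * x)) *
        exp (- ((y - \<mu> - \<beta> * x)\<^sup>2 / (2 * \<sigma>\<^sup>2 * x))) * g x) \<partial>lborel)"

end

theory Submission
  imports Defs "HOL-Real_Asymp.Real_Asymp"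
begin

text \<open>
  After normalising to \<open>\<mu> = 0\<close>, \<open>\<sigma> = 1\<close>, expanding the square gives \<open>f t = exp (b t) F t\<close>, where \<open>F\<close> is
  the scale mixture of centred normal densities with the tilted weight \<open>exp (- b\<^sup>2 x / 2) g x\<close>.
  It is even, and decreasing in \<open>\<bar>t\<bar>\<close>. The weight \<open>a exp (- a\<^sup>2 x / 2)\<close> has the scale mixture
  \<open>exp (- a \<bar>t\<bar>)\<close>, and in the variables \<open>1 / (2 x)\<close> and \<open>t\<^sup>2\<close> the kernel is that of a Laplace transform,
  hence variation diminishing on \<open>t \<ge> 0\<close>. So \<open>F\<close> crosses an exponential \<open>c exp (- a t)\<close> no more often
  than the weight crosses \<open>c a exp (- a\<^sup>2 x / 2)\<close>, and in the same order. Log-concavity and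
  log-convexity are statements about crossings with all exponentials; unimodality is one about
  crossings with constants, that is, of \<open>F\<close> with the multiples of \<open>exp (- b t)\<close>.
\<close>

subsection \<open>Comparison of scale mixtures of centred normal densities\<close>

text \<open>Crossing arguments are confined to \<open>t >= 0\<close>, since \<open>F\<close> depends
  on \<open>t\<close> through its square. For \<open>b >= 0\<close> the density is increasing left
  of 0, and \<open>b < 0\<close> is reduced to \<open>b > 0\<close> by reflection. Exponentials
  \<open>c * exp (- a * t)\<close> with \<open>a > 0\<close> are enough as comparison functions
  because \<open>F\<close> is strictly decreasing on \<open>t >= 0\<close>: every chord of its
  logarithm has negative slope. The main obstacle is \<open>t = 0\<close>, where \<open>F\<close>
  may be infinite. Mixtures are therefore never subtracted; terms are moved to the side where they
  are nonnegative, and only finite ones are cancelled. Crossings with constants give only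
  quasi-concavity. A mode also needs an attained supremum: total mass 1 provides a point where
  \<open>f\<close> is below its value at \<open>\<mu>\<close>, and \<open>F\<close> is continuous on
  \<open>t >= 0\<close> whenever it is finite at 0. Uniqueness of the mode needs a strict
  comparison; for a decreasing \<open>g\<close> there is a single sign change, which makes this
  possible.\<close>

definition normal_kernel :: "real \<Rightarrow> real \<Rightarrow> real" where
  "normal_kernel t x = exp (- (t\<^sup>2 / (2 * x))) / sqrt (2 * pi * x)"

text \<open>The variable \<open>x\<close> is a variance. The values are in \<open>ennreal\<close>
  because the integral may diverge at \<open>t = 0\<close>.\<close>

definition scale_mixture :: "(real \<Rightarrow> real) \<Rightarrow> real \<Rightarrow> ennreal" where
  "scale_mixture W t = (\<integral>\<^sup>+x\<in>{0<..}. ennreal (normal_kernel t x * W x) \<partial>lborel)"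

lemma normal_kernel_pos: "x > 0 \<Longrightarrow> normal_kernel t x > 0"
  by (simp add: normal_kernel_def)

lemma normal_kernel_measurable [measurable]: "normal_kernel t \<in> borel_measurable borel"
  unfolding normal_kernel_def by measurable

lemma is_interval_inverse_image:
  fixes J :: "real set"
  assumes "is_interval J"
  shows "is_interval {v. 0 < v \<and> 1 / (2 * v) \<in> J}"
  unfolding is_interval_1
proof (intro ballI allI impI)
  fix a b x :: real
  assume ab: "a \<in> {v. 0 < v \<and> 1 / (2 * v) \<in> J}" "b \<in> {v. 0 < v \<and> 1 / (2 * v) \<in> J}"
    and x: "a \<le> x \<and> x \<le> b"
  then have "1 / (2 * b) \<le> 1 / (2 * x)" "1 / (2 * x) \<le> 1 / (2 * a)"
    by (auto simp: field_simps)
  with ab assms have "1 / (2 * x) \<in> J"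
    unfolding is_interval_1 by blast
  with ab x show "x \<in> {v. 0 < v \<and> 1 / (2 * v) \<in> J}"
    by simp
qed

text \<open>A nonnegative combination of the two exponentials is convex, so once it equals 1 at
  \<open>r\<close> and at \<open>s\<close> it is at most 1 between them and at least 1 outside. For
  \<open>r = s\<close> the two conditions become tangency to the level 1.\<close>

lemma exp_combination_two_roots:
  fixes p q r s :: real
  assumes "p > 0" "q > 0" "r \<le> s"
  obtains A B where "A \<ge> 0" "B \<ge> 0"
    "\<And>v. r \<le> v \<Longrightarrow> v \<le> s \<Longrightarrow> A * exp (p * v) + B * exp (- q * v) \<le> 1"
    "\<And>v. v \<le> r \<or> s \<le> v \<Longrightarrow> A * exp (p * v) + B * exp (- q * v) \<ge> 1"
proof (cases "r = s")
  case True
  \<comment> \<open>Value 1 and derivative 0 at \<open>r\<close>. With these weights the linear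
    terms cancel when both exponentials are bounded below by their tangents at
    \<open>r\<close>.\<close>
  define A B where "A = q / (p + q) * exp (- p * r)" and "B = p / (p + q) * exp (q * r)"
  have eq: "A * exp (p * v) + B * exp (- q * v)
      = q / (p + q) * exp (p * (v - r)) + p / (p + q) * exp (- q * (v - r))" for v
    unfolding A_def B_def by (simp add: mult_exp_exp algebra_simps)
  have "A * exp (p * v) + B * exp (- q * v) \<ge> 1" for v
  proof -
    have "1 = q / (p + q) * (1 + p * (v - r)) + p / (p + q) * (1 + (- q * (v - r)))"
    proof -
      have "q / (p + q) * (1 + p * (v - r)) + p / (p + q) * (1 + (- q * (v - r)))
        = (q * (1 + p * (v - r)) + p * (1 + (- q * (v - r)))) / (p + q)"
        by (simp add: add_divide_distrib)
      also have "q * (1 + p * (v - r)) + p * (1 + (- q * (v - r))) = p + q"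
        by (simp add: algebra_simps)
      finally show ?thesis using assms by simp
    qed
    also have "\<dots> \<le> A * exp (p * v) + B * exp (- q * v)"
      unfolding eq using assms by (intro add_mono mult_left_mono exp_ge_add_one_self) auto
    finally show ?thesis .
  qed
  moreover have "A * exp (p * r) + B * exp (- q * r) = 1"
    unfolding eq using assms by (simp add: add_divide_distrib[symmetric])
  ultimately show thesis
    using assms True by (intro that[of A B]) (auto simp: A_def B_def)
next
  case False
  then have rs: "r < s" using assms by simp
  \<comment> \<open>Cramer's rule for the value 1 at \<open>r\<close> and at \<open>s\<close>;
    \<open>D\<close> is the determinant up to sign.\<close>
  define D where "D = exp (p * s - q * r) - exp (p * r - q * s)"
  define A B where "A = (exp (- q * r) - exp (- q * s)) / D" and "B = (exp (p * s) - exp (p * r)) / D"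
  have "p * r - q * s < p * s - q * r"
    using mult_strict_left_mono[OF rs assms(1)] mult_strict_left_mono[OF rs assms(2)] by linarith
  then have D: "D > 0" by (simp add: D_def)
  have A: "A > 0" and B: "B > 0"
    unfolding A_def B_def using assms rs D by (auto intro!: divide_pos_pos)
  define Q where "Q v = A * exp (p * v) + B * exp (- q * v)" for v
  have Qr: "Q r = 1"
  proof -
    have "Q r * D = (exp (- q * r) - exp (- q * s)) * exp (p * r) + (exp (p * s) - exp (p * r)) * exp (- q * r)"
      using D by (simp add: Q_def A_def B_def field_simps)
    also have "\<dots> = D" by (simp add: D_def algebra_simps mult_exp_exp)
    finally show ?thesis using D by simp
  qed
  have Qs: "Q s = 1"
  proof -
    have "Q s * D = (exp (- q * r) - exp (- q * s)) * exp (p * s) + (exp (p * s) - exp (p * r)) * exp (- q * s)"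
      using D by (simp add: Q_def A_def B_def field_simps)
    also have "\<dots> = D" by (simp add: D_def algebra_simps mult_exp_exp)
    finally show ?thesis using D by simp
  qed
  have conv: "convex_on UNIV Q"
  proof (rule f''_ge0_imp_convex)
    fix x :: real
    show "(Q has_real_derivative A * (p * exp (p * x)) + B * (- q * exp (- q * x))) (at x)"
      unfolding Q_def by (auto intro!: derivative_eq_intros)
    show "((\<lambda>x. A * (p * exp (p * x)) + B * (- q * exp (- q * x))) has_real_derivative
        A * (p * (p * exp (p * x))) + B * (q * (q * exp (- q * x)))) (at x)"
      by (auto intro!: derivative_eq_intros)
    show "0 \<le> A * (p * (p * exp (p * x))) + B * (q * (q * exp (- q * x)))"
      using A B assms by auto
  qed auto
  \<comment> \<open>Convexity with the denominator cleared, so that the unknown value can sit at any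
    of the three points.\<close>
  have secant: "(z - x) * Q y \<le> (z - y) * Q x + (y - x) * Q z" if "x < z" "x \<le> y" "y \<le> z" for x y z
  proof -
    define u where "u = (y - x) / (z - x)"
    have uz: "u * (z - x) = y - x" using that by (simp add: u_def)
    have u: "0 \<le> u" "u \<le> 1" using that by (simp_all add: u_def)
    have y: "y = (1 - u) * x + u * z" using uz by (simp add: algebra_simps)
    have "Q y \<le> (1 - u) * Q x + u * Q z"
      using convex_onD[OF conv u, of x z] y by simp
    then have "(z - x) * Q y \<le> (z - x) * ((1 - u) * Q x + u * Q z)"
      using that by (intro mult_left_mono) simp_all
    also have "\<dots> = ((z - x) - u * (z - x)) * Q x + u * (z - x) * Q z"
      by (simp add: algebra_simps)
    also have "\<dots> = (z - y) * Q x + (y - x) * Q z"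
      unfolding uz by simp
    finally show ?thesis .
  qed
  have "Q v \<le> 1" if "r \<le> v" "v \<le> s" for v
    using secant[of r s v] that rs Qr Qs by simp
  moreover have "Q v \<ge> 1" if "v \<le> r" for v
  proof -
    have "(s - r) * 1 \<le> (s - r) * Q v"
      using secant[of v s r] that rs Qr Qs by (simp add: algebra_simps)
    then show ?thesis using rs by simp
  qed
  moreover have "Q v \<ge> 1" if "s \<le> v" for v
  proof -
    have "(s - r) * 1 \<le> (s - r) * Q v"
      using secant[of r v s] that rs Qr Qs by (simp add: algebra_simps)
    then show ?thesis using rs by simp
  qed
  ultimately show thesis
    using A B by (intro that[of A B]) (auto simp: Q_def)
qed

text \<open>The finite endpoints of \<open>J\<close> serve as roots. The combination equals 1 there,
  so both inequalities hold whether or not an endpoint belongs to \<open>J\<close>. If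
  \<open>J\<close> is unbounded above, the growing exponential is dropped.\<close>

lemma exp_combination_interval:
  fixes p q :: real and J :: "real set"
  assumes "p > 0" "q > 0" "is_interval J" "bdd_below J"
  obtains A B where "A \<ge> 0" "B \<ge> 0"
    "\<And>v. v \<in> J \<Longrightarrow> A * exp (p * v) + B * exp (- q * v) \<le> 1"
    "\<And>v. v \<notin> J \<Longrightarrow> A * exp (p * v) + B * exp (- q * v) \<ge> 1"
proof -
  consider "J = {}" | "J \<noteq> {}" "bdd_above J" | "J \<noteq> {}" "\<not> bdd_above J" by fast
  then show thesis
  proof cases
    case 1
    \<comment> \<open>For either sign of \<open>v\<close> one of the two exponentials alone is at
      least 1.\<close>
    have "1 * exp (p * v) + 1 * exp (- q * v) \<ge> 1" for v
    proof (cases "v \<ge> 0")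
      case True
      then have "exp (p * v) \<ge> 1" using assms by simp
      then show ?thesis by (smt (verit) exp_gt_zero)
    next
      case False
      then have "exp (- q * v) \<ge> 1" using assms by (simp add: mult_nonneg_nonpos)
      then show ?thesis by (smt (verit) exp_gt_zero)
    qed
    with 1 show thesis by (intro that[of 1 1]) auto
  next
    case 2
    have *: "v \<in> J" if v: "Inf J < v" "v < Sup J" for v
    proof -
      obtain a b where "a \<in> J" "a < v" "b \<in> J" "v < b"
        using v 2 assms(4) by (meson cInf_less_iff less_cSup_iff)
      then show ?thesis
        using assms(3) unfolding is_interval_1 by (meson less_imp_le)
    qed
    have "Inf J \<le> Sup J" using 2 assms(4) by (simp add: cInf_le_cSup)
    from exp_combination_two_roots[OF assms(1,2) this] obtain A B where AB:
      "A \<ge> 0" "B \<ge> 0"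
      "\<And>v. Inf J \<le> v \<Longrightarrow> v \<le> Sup J \<Longrightarrow> A * exp (p * v) + B * exp (- q * v) \<le> 1"
      "\<And>v. v \<le> Inf J \<or> Sup J \<le> v \<Longrightarrow> A * exp (p * v) + B * exp (- q * v) \<ge> 1"
      by blast
    show thesis
    proof (rule that[OF AB(1,2)])
      fix v assume "v \<in> J"
      then show "A * exp (p * v) + B * exp (- q * v) \<le> 1"
        using AB(3) 2 assms(4) by (simp add: cInf_lower cSup_upper)
    next
      fix v assume "v \<notin> J"
      then show "A * exp (p * v) + B * exp (- q * v) \<ge> 1"
        using AB(4) * by (meson not_less)
    qed
  next
    case 3
    have *: "v \<in> J" if v: "Inf J < v" for v
    proof -
      obtain a where "a \<in> J" "a < v"
        using v 3 assms(4) by (meson cInf_less_iff)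
      moreover obtain b where "b \<in> J" "v < b"
        using 3 unfolding bdd_above_def by (meson not_le)
      ultimately show ?thesis
        using assms(3) unfolding is_interval_1 by (meson less_imp_le)
    qed
    \<comment> \<open>Only the decreasing exponential is kept, normalised to 1 at
      \<open>Inf J\<close>.\<close>
    have eq: "0 * exp (p * v) + exp (q * Inf J) * exp (- q * v) = exp (q * (Inf J - v))" for v
      by (simp add: mult_exp_exp algebra_simps)
    show thesis
    proof (rule that[of 0 "exp (q * Inf J)"])
      fix v assume "v \<in> J"
      then have "Inf J \<le> v" using assms(4) by (simp add: cInf_lower)
      then show "0 * exp (p * v) + exp (q * Inf J) * exp (- q * v) \<le> 1"
        unfolding eq using assms by (simp add: mult_nonneg_nonpos)
    next
      fix v assume "v \<notin> J"
      then have "v \<le> Inf J" using * by (meson not_less)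
      then show "0 * exp (p * v) + exp (q * Inf J) * exp (- q * v) \<ge> 1"
        unfolding eq using assms by simp
    qed auto
  qed
qed

text \<open>With \<open>v = 1 / (2 x)\<close> the kernels at \<open>r\<close> and \<open>t\<close>, divided by the one at \<open>s\<close>, become
  exponentials in \<open>v\<close>, one increasing and one decreasing.\<close>

lemma normal_kernel_interval:
  fixes J :: "real set"
  assumes "0 \<le> r" "r < s" "s < t" "is_interval J"
  obtains A B where "A \<ge> 0" "B \<ge> 0"
    "\<And>x. x > 0 \<Longrightarrow> x \<in> J \<Longrightarrow> A * normal_kernel r x + B * normal_kernel t x \<le> normal_kernel s x"
    "\<And>x. x > 0 \<Longrightarrow> x \<notin> J \<Longrightarrow> A * normal_kernel r x + B * normal_kernel t x \<ge> normal_kernel s x"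
proof -
  define J' where "J' = {v. 0 < v \<and> 1 / (2 * v) \<in> J}"
  have J': "is_interval J'" unfolding J'_def by (rule is_interval_inverse_image) fact
  \<comment> \<open>Positivity of \<open>v\<close> bounds \<open>J'\<close> from below, even if
    \<open>J\<close> is unbounded above; a \<open>J\<close> reaching down to 0 makes
    \<open>J'\<close> unbounded above.\<close>
  have bdd: "bdd_below J'" unfolding J'_def by (auto intro!: bdd_belowI[of _ 0])
  have p: "s\<^sup>2 - r\<^sup>2 > 0" "t\<^sup>2 - s\<^sup>2 > 0"
    using assms by (auto simp: power_strict_mono)
  obtain A B where AB: "A \<ge> 0" "B \<ge> 0"
    "\<And>v. v \<in> J' \<Longrightarrow> A * exp ((s\<^sup>2 - r\<^sup>2) * v) + B * exp (- (t\<^sup>2 - s\<^sup>2) * v) \<le> 1"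
    "\<And>v. v \<notin> J' \<Longrightarrow> A * exp ((s\<^sup>2 - r\<^sup>2) * v) + B * exp (- (t\<^sup>2 - s\<^sup>2) * v) \<ge> 1"
    using exp_combination_interval[OF p J' bdd] by blast
  have eq: "A * normal_kernel r x + B * normal_kernel t x = normal_kernel s x *
      (A * exp ((s\<^sup>2 - r\<^sup>2) * (1 / (2 * x))) + B * exp (- (t\<^sup>2 - s\<^sup>2) * (1 / (2 * x))))" if "x > 0" for x
  proof -
    have "exp (- (r\<^sup>2 / (2 * x))) = exp (- (s\<^sup>2 / (2 * x))) * exp ((s\<^sup>2 - r\<^sup>2) * (1 / (2 * x)))"
      "exp (- (t\<^sup>2 / (2 * x))) = exp (- (s\<^sup>2 / (2 * x))) * exp (- (t\<^sup>2 - s\<^sup>2) * (1 / (2 * x)))"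
      by (simp_all add: mult_exp_exp diff_divide_distrib)
    then show ?thesis
      by (simp only: normal_kernel_def) (simp add: distrib_left add_divide_distrib mult_ac)
  qed
  have mem: "1 / (2 * x) \<in> J' \<longleftrightarrow> x \<in> J" if "x > 0" for x
    using that by (simp add: J'_def)
  show thesis
  proof (rule that[OF AB(1,2)])
    fix x :: real assume x: "x > 0" "x \<in> J"
    show "A * normal_kernel r x + B * normal_kernel t x \<le> normal_kernel s x"
      unfolding eq[OF x(1)] using AB(3)[of "1 / (2 * x)"] mem[OF x(1)] x normal_kernel_pos[OF x(1), of s]
      by (intro mult_left_le) (simp_all only: less_imp_le)
  next
    fix x :: real assume x: "x > 0" "x \<notin> J"
    then have "A * exp ((s\<^sup>2 - r\<^sup>2) * (1 / (2 * x))) + B * exp (- (t\<^sup>2 - s\<^sup>2) * (1 / (2 * x))) \<ge> 1"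
      using AB(4) mem[OF x(1)] by blast
    from mult_left_mono[OF this less_imp_le[OF normal_kernel_pos[OF x(1), of s]]]
    show "A * normal_kernel r x + B * normal_kernel t x \<ge> normal_kernel s x"
      unfolding eq[OF x(1)] by simp
  qed
qed

text \<open>Lets a signed integrand be treated in \<open>ennreal\<close>: its positive and negative
  terms are collected on opposite sides, and two such sums are then compared as single integrals of
  nonnegative functions.\<close>

lemma scale_mixture_combination:
  fixes V W :: "real \<Rightarrow> real"
  assumes [measurable]: "V \<in> borel_measurable borel" "W \<in> borel_measurable borel"
    and V: "\<And>x. x > 0 \<Longrightarrow> V x \<ge> 0" and W: "\<And>x. x > 0 \<Longrightarrow> W x \<ge> 0"
    and A: "A \<ge> 0"
  shows "scale_mixture W s + ennreal A * scale_mixture V r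
    = (\<integral>\<^sup>+x\<in>{0<..}. ennreal (normal_kernel s x * W x + A * (normal_kernel r x * V x)) \<partial>lborel)"
proof -
  have "scale_mixture W s + ennreal A * scale_mixture V r
    = (\<integral>\<^sup>+x. ennreal (normal_kernel s x * W x) * indicator {0<..} x
        + ennreal A * (ennreal (normal_kernel r x * V x) * indicator {0<..} x) \<partial>lborel)"
    unfolding scale_mixture_def by (simp add: nn_integral_add nn_integral_cmult)
  also have "\<dots> = (\<integral>\<^sup>+x\<in>{0<..}. ennreal (normal_kernel s x * W x + A * (normal_kernel r x * V x)) \<partial>lborel)"
  proof (intro nn_integral_cong)
    fix x :: real
    show "ennreal (normal_kernel s x * W x) * indicator {0<..} x
        + ennreal A * (ennreal (normal_kernel r x * V x) * indicator {0<..} x)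
        = ennreal (normal_kernel s x * W x + A * (normal_kernel r x * V x)) * indicator {0<..} x"
    proof (cases "x > 0")
      case True
      then show ?thesis
        using A V W normal_kernel_pos[of x]
        by (simp add: ennreal_plus ennreal_mult less_imp_le)
    qed simp
  qed
  finally show ?thesis .
qed

lemma scale_mixture_combination2:
  fixes U V W :: "real \<Rightarrow> real"
  assumes [measurable]: "U \<in> borel_measurable borel" "V \<in> borel_measurable borel" "W \<in> borel_measurable borel"
    and U: "\<And>x. x > 0 \<Longrightarrow> U x \<ge> 0" and V: "\<And>x. x > 0 \<Longrightarrow> V x \<ge> 0" and W: "\<And>x. x > 0 \<Longrightarrow> W x \<ge> 0"
    and A: "A \<ge> 0" and B: "B \<ge> 0"
  shows "scale_mixture W s + ennreal A * scale_mixture V r + ennreal B * scale_mixture U t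
    = (\<integral>\<^sup>+x\<in>{0<..}. ennreal (normal_kernel s x * W x + A * (normal_kernel r x * V x)
        + B * (normal_kernel t x * U x)) \<partial>lborel)"
proof -
  have "scale_mixture W s + ennreal A * scale_mixture V r + ennreal B * scale_mixture U t
    = (\<integral>\<^sup>+x. ennreal (normal_kernel s x * W x + A * (normal_kernel r x * V x)) * indicator {0<..} x
        + ennreal B * (ennreal (normal_kernel t x * U x) * indicator {0<..} x) \<partial>lborel)"
    unfolding scale_mixture_combination[OF assms(2,3) V W A, simplified]
    by (simp add: scale_mixture_def nn_integral_add nn_integral_cmult)
  also have "\<dots> = (\<integral>\<^sup>+x\<in>{0<..}. ennreal (normal_kernel s x * W x + A * (normal_kernel r x * V x)
        + B * (normal_kernel t x * U x)) \<partial>lborel)"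
  proof (intro nn_integral_cong)
    fix x :: real
    show "ennreal (normal_kernel s x * W x + A * (normal_kernel r x * V x)) * indicator {0<..} x
        + ennreal B * (ennreal (normal_kernel t x * U x) * indicator {0<..} x)
        = ennreal (normal_kernel s x * W x + A * (normal_kernel r x * V x) + B * (normal_kernel t x * U x)) * indicator {0<..} x"
    proof (cases "x > 0")
      case True
      then show ?thesis
        using A B U V W normal_kernel_pos[of x]
        by (simp add: ennreal_plus ennreal_mult less_imp_le)
    qed simp
  qed
  finally show ?thesis .
qed

text \<open>This is variation diminution for at most two sign changes: if \<open>W - V\<close> is positive exactly on
  an interval, then multiplying it by the kernel combination with the same sign pattern gives a
  nonnegative integrand.\<close>

lemma scale_mixture_compare:
  fixes V W :: "real \<Rightarrow> real"
  assumes meas: "V \<in> borel_measurable borel" "W \<in> borel_measurable borel"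
    and V: "\<And>x. x > 0 \<Longrightarrow> V x \<ge> 0" and W: "\<And>x. x > 0 \<Longrightarrow> W x \<ge> 0"
    and rst: "0 \<le> r" "r < s" "s < t"
    and J: "is_interval {x. 0 < x \<and> V x < W x}"
    and le: "scale_mixture V r \<le> scale_mixture W r" "scale_mixture V t \<le> scale_mixture W t"
    and fin: "scale_mixture V r < \<infinity>" "scale_mixture V t < \<infinity>"
  shows "scale_mixture V s \<le> scale_mixture W s"
proof -
  obtain A B where AB: "A \<ge> 0" "B \<ge> 0"
    "\<And>x. x > 0 \<Longrightarrow> x \<in> {x. 0 < x \<and> V x < W x} \<Longrightarrow> A * normal_kernel r x + B * normal_kernel t x \<le> normal_kernel s x"
    "\<And>x. x > 0 \<Longrightarrow> x \<notin> {x. 0 < x \<and> V x < W x} \<Longrightarrow> A * normal_kernel r x + B * normal_kernel t x \<ge> normal_kernel s x"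
    using normal_kernel_interval[OF rst J] by blast
  \<comment> \<open>This is a product of two factors of equal sign, with the negative terms moved to
    the other side.\<close>
  have pointwise: "normal_kernel s x * V x + A * (normal_kernel r x * W x) + B * (normal_kernel t x * W x)
      \<le> normal_kernel s x * W x + A * (normal_kernel r x * V x) + B * (normal_kernel t x * V x)" if "x > 0" for x
  proof -
    have "0 \<le> (normal_kernel s x - (A * normal_kernel r x + B * normal_kernel t x)) * (W x - V x)"
      using AB(3,4)[OF that] that by (cases "V x < W x") (auto intro: mult_nonneg_nonneg mult_nonpos_nonpos)
    then show ?thesis by (simp add: algebra_simps)
  qed
  have "scale_mixture V s + ennreal A * scale_mixture V r + ennreal B * scale_mixture V t
      \<le> scale_mixture V s + ennreal A * scale_mixture W r + ennreal B * scale_mixture W t"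
    by (intro add_mono mult_left_mono le) auto
  also have "\<dots> \<le> scale_mixture W s + ennreal A * scale_mixture V r + ennreal B * scale_mixture V t"
    unfolding scale_mixture_combination2[OF meas(2) meas(2,1) W W V AB(1,2), simplified]
      scale_mixture_combination2[OF meas(1) meas V V W AB(1,2), simplified]
    using pointwise by (intro nn_integral_mono) (auto simp: indicator_def intro!: ennreal_leI)
  finally have "(ennreal A * scale_mixture V r + ennreal B * scale_mixture V t) + scale_mixture V s
     \<le> (ennreal A * scale_mixture V r + ennreal B * scale_mixture V t) + scale_mixture W s"
    by (simp add: ac_simps)
  \<comment> \<open>Only mixtures of \<open>V\<close> are cancelled, so the mixture of
    \<open>W\<close> may be infinite, as can happen at \<open>r = 0\<close>.\<close>
  moreover have "ennreal A * scale_mixture V r + ennreal B * scale_mixture V t \<noteq> \<infinity>"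
    using fin by (auto simp: ennreal_mult_eq_top_iff)
  ultimately show ?thesis
    by (metis ennreal_add_left_cancel_le infinity_ennreal_def)
qed

subsection \<open>Exponential mixing weights\<close>

text \<open>The cdf and an antiderivative \<open>F\<close> of the density have the same increments
  to the right of \<open>x - 1\<close>, hence differ by a constant near \<open>x\<close>. The base
  point only has to lie below \<open>x\<close>.\<close>

lemma std_normal_cdf_deriv:
  "(cdf std_normal_distribution has_real_derivative std_normal_density x) (at x)"
proof -
  interpret real_distribution std_normal_distribution
    by (rule real_dist_normal_dist)
  obtain F where F: "\<And>x. (F has_real_derivative std_normal_density x) (at x)"
  proof -
    have "\<exists>F. \<forall>x :: real. -\<infinity> < ereal x \<longrightarrow> ereal x < \<infinity> \<longrightarrow> (F has_vector_derivative std_normal_density x) (at x)"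
      by (rule einterval_antiderivative) (auto simp: std_normal_density_def intro!: continuous_intros)
    then show ?thesis using that by (auto simp: has_real_derivative_iff_has_vector_derivative)
  qed
  have eq: "cdf std_normal_distribution u = cdf std_normal_distribution (x - 1) - F (x - 1) + F u" if "u > x - 1" for u
  proof -
    have "ennreal (measure std_normal_distribution {x - 1<..u}) = emeasure std_normal_distribution {x - 1<..u}"
      by (simp add: emeasure_eq_measure)
    also have "\<dots> = (\<integral>\<^sup>+v. ennreal (std_normal_density v) * indicator {x - 1<..u} v \<partial>lborel)"
      by (simp add: emeasure_density)
    also have "\<dots> = (\<integral>\<^sup>+v. ennreal (std_normal_density v) * indicator {x - 1..u} v \<partial>lborel)"
    proof (intro nn_integral_cong_AE)
      have "AE v in lborel. v \<noteq> x - 1" by (rule AE_lborel_singleton)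
      then show "AE v in lborel. ennreal (std_normal_density v) * indicator {x - 1<..u} v
          = ennreal (std_normal_density v) * indicator {x - 1..u} v"
        by eventually_elim (simp add: indicator_def)
    qed
    also have "\<dots> = ennreal (F u - F (x - 1))"
      using that by (intro nn_integral_FTC_Icc) (simp_all add: F has_field_derivative_at_within)
    finally have "ennreal (measure std_normal_distribution {x - 1<..u}) = ennreal (F u - F (x - 1))" .
    moreover have "F (x - 1) \<le> F u"
      using that by (intro deriv_nonneg_imp_mono[of "x - 1" u F std_normal_density]) (simp_all add: F)
    ultimately have "measure std_normal_distribution {x - 1<..u} = F u - F (x - 1)"
      by simp
    then show ?thesis using cdf_diff_eq[OF that] by linarith
  qed
  have "((\<lambda>u. cdf std_normal_distribution (x - 1) - F (x - 1) + F u) has_real_derivative std_normal_density x) (at x)"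
    using DERIV_add[OF DERIV_const F] by simp
  then show ?thesis
    by (rule has_field_derivative_transform_within_open[where S = "{x - 1<..}"]) (auto simp: eq)
qed

text \<open>Up to normalisation, this is the Laplace law as a normal law with exponentially
  distributed variance. The integral has an explicit antiderivative in \<open>x\<close> in terms of
  the normal cdf.\<close>

lemma scale_mixture_exp:
  assumes a: "a > 0" and t: "t \<ge> 0"
  shows "scale_mixture (\<lambda>x. exp (- (a\<^sup>2 * x / 2))) t = ennreal (exp (- a * t) / a)"
proof -
  interpret real_distribution std_normal_distribution
    by (rule real_dist_normal_dist)
  define \<Phi> where "\<Phi> = cdf std_normal_distribution"
  have \<Phi>_deriv: "(\<Phi> has_real_derivative std_normal_density x) (at x)" for x
    unfolding \<Phi>_def by (rule std_normal_cdf_deriv)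
  have top: "(\<Phi> \<longlongrightarrow> 1) at_top" and bot: "(\<Phi> \<longlongrightarrow> 0) at_bot"
    unfolding \<Phi>_def by (rule cdf_lim_at_top_prob cdf_lim_at_bot)+
  \<comment> \<open>The factors \<open>exp (- a * t)\<close> and \<open>exp (a * t)\<close> undo the
    cross terms of the two squared arguments, so after differentiation both summands carry the same
    Gaussian factor \<open>R\<close>.\<close>
  define P where "P x = (exp (- a * t) * \<Phi> (a * sqrt x - t / sqrt x) - exp (a * t) * \<Phi> (- a * sqrt x - t / sqrt x)) / a" for x
  define f where "f x = normal_kernel t x * exp (- (a\<^sup>2 * x / 2))" for x
  have deriv: "(P has_real_derivative f x) (at x)" if x: "x > 0" for x
  proof -
    define R where "R = exp (- (t\<^sup>2 / (2 * x))) * exp (- (a\<^sup>2 * x / 2)) / sqrt (2 * pi)"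
    have r: "sqrt x > 0" "sqrt x * sqrt x = x" using x by auto
    have e1: "exp (- a * t) * std_normal_density (a * sqrt x - t / sqrt x) = R"
    proof -
      have "- a * t - (a * sqrt x - t / sqrt x)\<^sup>2 / 2 = - (t\<^sup>2 / (2 * x)) - (a\<^sup>2 * x / 2)"
        using x r by (simp add: power2_eq_square field_simps)
      then show ?thesis
        by (simp add: std_normal_density_def R_def mult_exp_exp)
    qed
    have e2: "exp (a * t) * std_normal_density (- a * sqrt x - t / sqrt x) = R"
    proof -
      have "a * t - (- a * sqrt x - t / sqrt x)\<^sup>2 / 2 = - (t\<^sup>2 / (2 * x)) - (a\<^sup>2 * x / 2)"
        using x r by (simp add: power2_eq_square field_simps)
      then show ?thesis
        by (simp add: std_normal_density_def R_def mult_exp_exp)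
    qed
    define d e where "d = inverse (sqrt x) / 2" and "e = d / x"
    have sq: "(sqrt has_real_derivative d) (at x)"
      unfolding d_def using x by (rule DERIV_real_sqrt)
    have isq: "((\<lambda>x. t / sqrt x) has_real_derivative - t * e) (at x)"
    proof -
      have "((\<lambda>x. t / sqrt x) has_real_derivative (0 * sqrt x - t * d) / (sqrt x * sqrt x)) (at x)"
        using r(1) by (intro DERIV_divide DERIV_const sq) simp
      then show ?thesis using r(2) by (simp add: e_def)
    qed
    have i1: "((\<lambda>x. a * sqrt x - t / sqrt x) has_real_derivative a * d - - t * e) (at x)"
      by (intro DERIV_diff DERIV_cmult sq isq)
    have i2: "((\<lambda>x. - a * sqrt x - t / sqrt x) has_real_derivative - a * d - - t * e) (at x)"
      by (intro DERIV_diff DERIV_cmult sq isq)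
    define u v where "u = a * d - - t * e" and "v = - a * d - - t * e"
    have "(P has_real_derivative (exp (- a * t) * (std_normal_density (a * sqrt x - t / sqrt x) * u)
        - exp (a * t) * (std_normal_density (- a * sqrt x - t / sqrt x) * v)) / a) (at x)"
      unfolding P_def u_def v_def
      by (intro DERIV_cdivide DERIV_diff DERIV_cmult DERIV_chain2[OF \<Phi>_deriv] i1 i2)
    then have D: "(P has_real_derivative (R * u - R * v) / a) (at x)"
      unfolding mult.assoc[symmetric] e1 e2 .
    \<comment> \<open>The contribution of \<open>t / sqrt x\<close> is the same in \<open>u\<close>
      and \<open>v\<close> and drops out.\<close>
    have "u - v = a * (2 * d)" by (simp add: u_def v_def)
    then have "(R * u - R * v) / a = R * (2 * d)"
      using a by (simp add: right_diff_distrib[symmetric])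
    moreover have "R * (2 * d) = f x"
    proof -
      have "sqrt (2 * pi * x) = sqrt (2 * pi) * sqrt x" by (rule real_sqrt_mult)
      then have "normal_kernel t x = exp (- (t\<^sup>2 / (2 * x))) / sqrt (2 * pi) * inverse (sqrt x)"
        unfolding normal_kernel_def by (simp only: divide_inverse inverse_mult_distrib mult.assoc)
      moreover have "2 * d = inverse (sqrt x)" by (simp add: d_def)
      ultimately show ?thesis unfolding R_def f_def
        by (simp only: times_divide_eq_left times_divide_eq_right mult_ac)
    qed
    ultimately show ?thesis using D by (simp only:)
  qed
  have lim_top: "(P \<longlongrightarrow> exp (- a * t) / a) at_top"
  proof -
    have "filterlim (\<lambda>x. a * sqrt x - t / sqrt x) at_top at_top" "filterlim (\<lambda>x. - a * sqrt x - t / sqrt x) at_bot at_top"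
      using a by real_asymp+
    then have "((\<lambda>x. \<Phi> (a * sqrt x - t / sqrt x)) \<longlongrightarrow> 1) at_top" "((\<lambda>x. \<Phi> (- a * sqrt x - t / sqrt x)) \<longlongrightarrow> 0) at_top"
      by (auto intro: filterlim_compose[OF top] filterlim_compose[OF bot])
    then show ?thesis
      unfolding P_def using a by (auto intro!: tendsto_eq_intros)
  qed
  have lim_0: "(P \<longlongrightarrow> 0) (at_right 0)"
  \<comment> \<open>For \<open>t = 0\<close> both arguments tend to 0 and the two values
    \<open>\<Phi> 0\<close> cancel; for \<open>t > 0\<close> both tend to minus infinity.\<close>
  proof (cases "t = 0")
    case True
    have c: "isCont \<Phi> 0" using \<Phi>_deriv DERIV_isCont by blast
    have "((\<lambda>x. a * sqrt x) \<longlongrightarrow> 0) (at_right 0)" "((\<lambda>x. - a * sqrt x) \<longlongrightarrow> 0) (at_right 0)"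
      using a by real_asymp+
    then have "((\<lambda>x. \<Phi> (a * sqrt x)) \<longlongrightarrow> \<Phi> 0) (at_right 0)" "((\<lambda>x. \<Phi> (- a * sqrt x)) \<longlongrightarrow> \<Phi> 0) (at_right 0)"
      by (auto intro: isCont_tendsto_compose[OF c])
    then show ?thesis
      unfolding P_def True using a by (auto intro!: tendsto_eq_intros)
  next
    case False
    then have "t > 0" using t by simp
    then have "filterlim (\<lambda>x. a * sqrt x - t / sqrt x) at_bot (at_right 0)" "filterlim (\<lambda>x. - a * sqrt x - t / sqrt x) at_bot (at_right 0)"
      using a by real_asymp+
    then have "((\<lambda>x. \<Phi> (a * sqrt x - t / sqrt x)) \<longlongrightarrow> 0) (at_right 0)" "((\<lambda>x. \<Phi> (- a * sqrt x - t / sqrt x)) \<longlongrightarrow> 0) (at_right 0)"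
      by (auto intro: filterlim_compose[OF bot])
    then show ?thesis
      unfolding P_def using a by (auto intro!: tendsto_eq_intros)
  qed
  have cont: "isCont f x" if "x > 0" for x
    unfolding f_def normal_kernel_def using that by (auto intro!: continuous_intros)
  have nonneg: "f x \<ge> 0" if "x > 0" for x
    using normal_kernel_pos[OF that] by (simp add: f_def less_imp_le)
  have FTC: "set_integrable lborel (einterval 0 \<infinity>) f" "(LBINT x=0..\<infinity>. f x) = exp (- a * t) / a - 0"
    by (rule interval_integral_FTC_nonneg[where F = P];
        use deriv cont nonneg lim_top lim_0 in \<open>auto simp: zero_ereal_def ereal_tendsto_simps\<close>)+
  have ei: "einterval 0 \<infinity> = {0<..}" by (auto simp: einterval_def)
  have "scale_mixture (\<lambda>x. exp (- (a\<^sup>2 * x / 2))) t = (\<integral>\<^sup>+x. ennreal (indicator {0<..} x * f x) \<partial>lborel)"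
    unfolding scale_mixture_def f_def by (intro nn_integral_cong) (simp add: indicator_def)
  also have "\<dots> = ennreal (\<integral>x. indicator {0<..} x * f x \<partial>lborel)"
  proof (rule nn_integral_eq_integral)
    show "integrable lborel (\<lambda>x. indicator {0<..} x * f x)"
      using FTC(1) by (simp add: set_integrable_def ei)
    show "AE x in lborel. 0 \<le> indicator {0<..} x * f x"
      by (intro AE_I2) (simp add: indicator_def nonneg)
  qed
  also have "(\<integral>x. indicator {0<..} x * f x \<partial>lborel) = exp (- a * t) / a"
    using FTC(2) by (simp add: interval_lebesgue_integral_def set_lebesgue_integral_def ei)
  finally show ?thesis .
qed

lemma scale_mixture_cmult:
  assumes "k \<ge> 0" and [measurable]: "W \<in> borel_measurable borel"
  shows "scale_mixture (\<lambda>x. k * W x) t = ennreal k * scale_mixture W t"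
proof -
  have "scale_mixture (\<lambda>x. k * W x) t = (\<integral>\<^sup>+x. ennreal k * (ennreal (normal_kernel t x * W x) * indicator {0<..} x) \<partial>lborel)"
    unfolding scale_mixture_def
  proof (intro nn_integral_cong)
    fix x :: real
    have "ennreal (normal_kernel t x * (k * W x)) = ennreal k * ennreal (normal_kernel t x * W x)"
      using assms(1) by (simp add: ennreal_mult'[symmetric] mult_ac)
    then show "ennreal (normal_kernel t x * (k * W x)) * indicator {0<..} x
      = ennreal k * (ennreal (normal_kernel t x * W x) * indicator {0<..} x)"
      by (simp only: mult.assoc)
  qed
  also have "\<dots> = ennreal k * scale_mixture W t"
    unfolding scale_mixture_def by (intro nn_integral_cmult) measurable
  finally show ?thesis .
qed

lemma scale_mixture_exp_cmult:
  assumes "a > 0" "c > 0" "t \<ge> 0"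
  shows "scale_mixture (\<lambda>x. c * a * exp (- (a\<^sup>2 * x / 2))) t = ennreal (c * exp (- a * t))"
proof -
  have "scale_mixture (\<lambda>x. c * a * exp (- (a\<^sup>2 * x / 2))) t = ennreal (c * a) * ennreal (exp (- a * t) / a)"
    using assms scale_mixture_cmult[of "c * a" "\<lambda>x. exp (- (a\<^sup>2 * x / 2))" t] scale_mixture_exp[of a t] by simp
  also have "\<dots> = ennreal (c * exp (- a * t))"
    using assms by (simp add: ennreal_mult'[symmetric])
  finally show ?thesis .
qed

subsection \<open>Regularity and monotonicity\<close>

lemma set_nn_integral_strict_mono:
  fixes u v :: "real \<Rightarrow> real"
  assumes [measurable]: "u \<in> borel_measurable borel" "v \<in> borel_measurable borel" "S \<in> sets borel"
    and nonneg: "\<And>x. x \<in> S \<Longrightarrow> 0 \<le> u x" and le: "\<And>x. x \<in> S \<Longrightarrow> u x \<le> v x"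
    and ne: "\<not> (AE x in lborel. x \<in> S \<longrightarrow> u x = v x)"
    and fin: "(\<integral>\<^sup>+x\<in>S. ennreal (u x) \<partial>lborel) < \<infinity>"
  shows "(\<integral>\<^sup>+x\<in>S. ennreal (u x) \<partial>lborel) < (\<integral>\<^sup>+x\<in>S. ennreal (v x) \<partial>lborel)"
proof (rule nn_integral_less)
  show "AE x in lborel. ennreal (u x) * indicator S x \<le> ennreal (v x) * indicator S x"
    using le by (intro AE_I2) (auto simp: indicator_def intro: ennreal_leI)
  show "\<not> (AE x in lborel. ennreal (v x) * indicator S x \<le> ennreal (u x) * indicator S x)"
  proof
    assume "AE x in lborel. ennreal (v x) * indicator S x \<le> ennreal (u x) * indicator S x"
    then have "AE x in lborel. x \<in> S \<longrightarrow> u x = v x"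
    proof eventually_elim
      fix x assume *: "ennreal (v x) * indicator S x \<le> ennreal (u x) * indicator S x"
      show "x \<in> S \<longrightarrow> u x = v x"
      proof
        assume x: "x \<in> S"
        with * have "v x \<le> u x" using nonneg[OF x] by (simp add: ennreal_le_iff)
        with le[OF x] show "u x = v x" by simp
      qed
    qed
    with ne show False by contradiction
  qed
qed (use fin in auto)

lemma scale_mixture_uminus: "scale_mixture W (- t) = scale_mixture W t"
  by (simp add: scale_mixture_def normal_kernel_def)

lemma scale_mixture_abs: "scale_mixture W \<bar>t\<bar> = scale_mixture W t"
  by (simp add: abs_if scale_mixture_uminus)

lemma normal_kernel_less:
  assumes "x > 0" "0 \<le> s" "s < t"
  shows "normal_kernel t x < normal_kernel s x"
proof -
  have "s\<^sup>2 < t\<^sup>2" using assms by (simp add: power_strict_mono)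
  then have "s\<^sup>2 / (2 * x) < t\<^sup>2 / (2 * x)"
    using assms by (simp add: divide_strict_right_mono)
  then show ?thesis
    using assms by (simp add: normal_kernel_def divide_strict_right_mono)
qed

text \<open>Away from \<open>t = 0\<close> the Gaussian factor absorbs the singularity of
  \<open>1 / sqrt x\<close> at 0. A bound uniform in \<open>x\<close> makes the mixture of any
  weight of finite mass finite there.\<close>

lemma normal_kernel_bound:
  assumes x: "x > 0" and t: "t \<noteq> 0"
  shows "normal_kernel t x \<le> 1 + 2 / t\<^sup>2"
proof (cases "x \<ge> 1")
  case True
  have "1 * 1 \<le> (2 * pi) * x"
    using True pi_gt3 by (intro mult_mono) auto
  then have "sqrt (2 * pi * x) \<ge> 1" by simp
  then have "normal_kernel t x \<le> 1 / 1"
    unfolding normal_kernel_def using x by (intro frac_le) auto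
  also have "\<dots> \<le> 1 + 2 / t\<^sup>2" by simp
  finally show ?thesis .
next
  case False
  define u where "u = t\<^sup>2 / (2 * x)"
  have u: "u > 0" using x t by (simp add: u_def)
  have "u \<le> exp u" using exp_ge_add_one_self[of u] by linarith
  then have e: "exp (- u) \<le> 1 / u"
    using u by (simp add: exp_minus field_simps)
  \<comment> \<open>Replacing the root by the smaller \<open>x\<close> makes the denominator cancel
    against the factor \<open>x\<close> in \<open>1 / u\<close>.\<close>
  have "x * x \<le> (2 * pi) * x"
    using False x pi_gt3 by (intro mult_right_mono) auto
  then have "x \<le> sqrt (2 * pi * x)"
    by (intro real_le_rsqrt) (simp add: power2_eq_square)
  then have "normal_kernel t x \<le> (1 / u) / x"
    unfolding normal_kernel_def u_def[symmetric] using x e u by (intro frac_le) auto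
  also have "\<dots> = 2 / t\<^sup>2"
    using x t by (simp add: u_def)
  finally show ?thesis by simp
qed

text \<open>Finite nonzero mass instead of mass 1, so that the tilted weight is again an
  instance.\<close>

locale mixing_weight =
  fixes W :: "real \<Rightarrow> real"
  assumes meas [measurable]: "W \<in> borel_measurable borel"
    and nonneg: "x > 0 \<Longrightarrow> W x \<ge> 0"
    and finite_mass: "(\<integral>\<^sup>+x\<in>{0<..}. ennreal (W x) \<partial>lborel) < \<infinity>"
    and not_null: "\<not> (AE x in lborel. x > 0 \<longrightarrow> W x = 0)"
begin

lemma scale_mixture_pos: "0 < scale_mixture W t"
proof (rule ccontr)
  assume "\<not> 0 < scale_mixture W t"
  then have "scale_mixture W t = 0" by simp
  then have "AE x in lborel. ennreal (normal_kernel t x * W x) * indicator {0<..} x = 0"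
    unfolding scale_mixture_def by (subst (asm) nn_integral_0_iff_AE) simp_all
  then have "AE x in lborel. x > 0 \<longrightarrow> W x = 0"
  proof eventually_elim
    fix x :: real
    assume 0: "ennreal (normal_kernel t x * W x) * indicator {0<..} x = 0"
    show "x > 0 \<longrightarrow> W x = 0"
    proof
      assume x: "x > 0"
      with 0 have "normal_kernel t x * W x \<le> 0" by (simp add: ennreal_eq_0_iff)
      with nonneg[OF x] normal_kernel_pos[OF x, of t] show "W x = 0"
        by (simp add: mult_le_0_iff)
    qed
  qed
  with not_null show False by contradiction
qed

lemma scale_mixture_finite:
  assumes "t \<noteq> 0"
  shows "scale_mixture W t < \<infinity>"
proof -
  have "scale_mixture W t \<le> (\<integral>\<^sup>+x. ennreal (1 + 2 / t\<^sup>2) * (ennreal (W x) * indicator {0<..} x) \<partial>lborel)"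
    unfolding scale_mixture_def
  proof (intro nn_integral_mono)
    fix x :: real
    show "ennreal (normal_kernel t x * W x) * indicator {0<..} x \<le> ennreal (1 + 2 / t\<^sup>2) * (ennreal (W x) * indicator {0<..} x)"
    proof (cases "x > 0")
      case True
      then have "normal_kernel t x * W x \<le> (1 + 2 / t\<^sup>2) * W x"
        using normal_kernel_bound[OF True assms] nonneg[OF True] by (intro mult_right_mono)
      then have "ennreal (normal_kernel t x * W x) \<le> ennreal ((1 + 2 / t\<^sup>2) * W x)"
        by (rule ennreal_leI)
      also have "\<dots> = ennreal (1 + 2 / t\<^sup>2) * ennreal (W x)"
        using nonneg[OF True] by (intro ennreal_mult) auto
      finally show ?thesis using True by simp
    qed simp
  qed
  also have "\<dots> = ennreal (1 + 2 / t\<^sup>2) * (\<integral>\<^sup>+x\<in>{0<..}. ennreal (W x) \<partial>lborel)"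
    by (intro nn_integral_cmult) simp
  also have "\<dots> < \<infinity>"
    using finite_mass by (simp add: ennreal_mult_less_top)
  finally show ?thesis .
qed

lemma scale_mixture_strict_antimono:
  assumes "0 \<le> s" "s < t"
  shows "scale_mixture W t < scale_mixture W s"
  unfolding scale_mixture_def
proof (rule set_nn_integral_strict_mono)
  fix x :: real assume x: "x \<in> {0<..}"
  then show "0 \<le> normal_kernel t x * W x"
    using nonneg normal_kernel_pos[of x t] by simp
  show "normal_kernel t x * W x \<le> normal_kernel s x * W x"
    using x nonneg normal_kernel_less[OF _ assms, of x] by (intro mult_right_mono) auto
next
  show "\<not> (AE x in lborel. x \<in> {0<..} \<longrightarrow> normal_kernel t x * W x = normal_kernel s x * W x)"
  proof
    assume "AE x in lborel. x \<in> {0<..} \<longrightarrow> normal_kernel t x * W x = normal_kernel s x * W x"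
    then have "AE x in lborel. x > 0 \<longrightarrow> W x = 0"
      by eventually_elim (use normal_kernel_less[OF _ assms] in force)
    with not_null show False by contradiction
  qed
  show "(\<integral>\<^sup>+x\<in>{0<..}. ennreal (normal_kernel t x * W x) \<partial>lborel) < \<infinity>"
    using scale_mixture_finite[of t] assms by (simp add: scale_mixture_def)
qed measurable

lemma scale_mixture_antimono: "0 \<le> s \<Longrightarrow> s \<le> t \<Longrightarrow> scale_mixture W t \<le> scale_mixture W s"
  using scale_mixture_strict_antimono[of s t] by (cases "s = t") auto

text \<open>The kernel at 0 dominates all the others; finiteness at 0 is what dominated convergence
  needs.\<close>

lemma scale_mixture_continuous_on:
  assumes fin: "scale_mixture W 0 < \<infinity>"
  shows "continuous_on {0..} (scale_mixture W)"
  unfolding continuous_on_sequentially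
proof (intro ballI allI impI)
  fix a :: real and X :: "nat \<Rightarrow> real"
  assume a: "a \<in> {0..}" and X: "(\<forall>n. X n \<in> {0..}) \<and> X \<longlonglongrightarrow> a"
  show "(scale_mixture W \<circ> X) \<longlonglongrightarrow> scale_mixture W a"
    unfolding scale_mixture_def comp_def
  proof (rule nn_integral_dominated_convergence[where w = "\<lambda>x. ennreal (normal_kernel 0 x * W x) * indicator {0<..} x"])
    show "(\<integral>\<^sup>+x\<in>{0<..}. ennreal (normal_kernel 0 x * W x) \<partial>lborel) < \<infinity>"
      using fin by (simp add: scale_mixture_def)
    show "AE x in lborel. ennreal (normal_kernel (X n) x * W x) * indicator {0<..} x
        \<le> ennreal (normal_kernel 0 x * W x) * indicator {0<..} x" for n
    proof (intro AE_I2)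
      fix x :: real
      show "ennreal (normal_kernel (X n) x * W x) * indicator {0<..} x
        \<le> ennreal (normal_kernel 0 x * W x) * indicator {0<..} x"
      proof (cases "x > 0")
        case True
        then have "normal_kernel (X n) x \<le> normal_kernel 0 x"
          by (simp add: normal_kernel_def divide_right_mono)
        then show ?thesis
          using True nonneg[OF True] by (simp add: ennreal_leI mult_right_mono)
      qed simp
    qed
    show "AE x in lborel. (\<lambda>n. ennreal (normal_kernel (X n) x * W x) * indicator {0<..} x)
        \<longlonglongrightarrow> ennreal (normal_kernel a x * W x) * indicator {0<..} x"
    proof (intro AE_I2)
      fix x :: real
      show "(\<lambda>n. ennreal (normal_kernel (X n) x * W x) * indicator {0<..} x)
        \<longlonglongrightarrow> ennreal (normal_kernel a x * W x) * indicator {0<..} x"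
      proof (cases "x > 0")
        case True
        have Xa: "X \<longlonglongrightarrow> a" using X by simp
        have "(\<lambda>n. normal_kernel (X n) x * W x) \<longlonglongrightarrow> normal_kernel a x * W x"
          unfolding normal_kernel_def using True by (intro tendsto_intros Xa) auto
        then show ?thesis using True by simp
      qed simp
    qed
  qed measurable
qed

end

text \<open>The strict form for one sign change: \<open>W - V\<close> is positive on an initial
  segment and is multiplied by \<open>normal_kernel r x - A * normal_kernel s x\<close>, whose sign
  changes at the same point. It will show that the density decreases strictly to the right of its
  mode.\<close>

lemma scale_mixture_compare_initial:
  fixes V W :: "real \<Rightarrow> real"
  assumes meas [measurable]: "V \<in> borel_measurable borel" "W \<in> borel_measurable borel"
    and V: "\<And>x. x > 0 \<Longrightarrow> V x \<ge> 0" and W: "\<And>x. x > 0 \<Longrightarrow> W x \<ge> 0"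
    and rs: "0 \<le> r" "r < s"
    and J: "\<And>x y. 0 < x \<Longrightarrow> x \<le> y \<Longrightarrow> V y < W y \<Longrightarrow> V x < W x"
    and bound: "\<And>x. x > 0 \<Longrightarrow> V x < W x \<Longrightarrow> x \<le> K"
    and ne: "\<not> (AE x in lborel. x > 0 \<longrightarrow> V x = W x)"
    and le: "scale_mixture V s \<le> scale_mixture W s"
    and fin: "scale_mixture V r < \<infinity>" "scale_mixture V s < \<infinity>" "scale_mixture W s < \<infinity>"
  shows "scale_mixture V r < scale_mixture W r"
proof (cases "\<exists>x>0. V x < W x")
  case False
  \<comment> \<open>Without a point where \<open>V < W\<close>, the weights are ordered the other
    way and differ on a set of positive measure, which contradicts the inequality assumed at
    \<open>s\<close>.\<close>
  have "scale_mixture W s < scale_mixture V s"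
    unfolding scale_mixture_def
  proof (rule set_nn_integral_strict_mono)
    fix x :: real assume x: "x \<in> {0<..}"
    then show "0 \<le> normal_kernel s x * W x"
      using W normal_kernel_pos[of x s] by simp
    show "normal_kernel s x * W x \<le> normal_kernel s x * V x"
    proof (rule mult_left_mono)
      show "W x \<le> V x" using x False by (meson greaterThan_iff not_less)
      show "0 \<le> normal_kernel s x" using x normal_kernel_pos[of x s] by simp
    qed
  next
    show "\<not> (AE x in lborel. x \<in> {0<..} \<longrightarrow> normal_kernel s x * W x = normal_kernel s x * V x)"
    proof
      assume "AE x in lborel. x \<in> {0<..} \<longrightarrow> normal_kernel s x * W x = normal_kernel s x * V x"
      then have "AE x in lborel. x > 0 \<longrightarrow> V x = W x"
        by eventually_elim (use normal_kernel_pos[of _ s] in force)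
      with ne show False by contradiction
    qed
    show "(\<integral>\<^sup>+x\<in>{0<..}. ennreal (normal_kernel s x * W x) \<partial>lborel) < \<infinity>"
      using fin(3) by (simp add: scale_mixture_def)
  qed measurable
  with le show ?thesis by simp
next
  case True
  define J where "J = {x. x > 0 \<and> V x < W x}"
  define z where "z = Sup J"
  have Jne: "J \<noteq> {}" using True by (auto simp: J_def)
  have bdd: "bdd_above J" using bound by (auto simp: J_def bdd_above_def)
  have up: "x \<le> z" if "x \<in> J" for x
    unfolding z_def using that bdd by (rule cSup_upper)
  have z: "z > 0"
    using Jne up by (force simp: J_def)
  have low: "z \<le> x" if "x > 0" "x \<notin> J" for x
    unfolding z_def
  proof (rule cSup_least[OF Jne])
    fix y assume "y \<in> J"
    with that J[of x y] show "y \<le> x"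
      unfolding J_def by force
  qed
  define q where "q = (s\<^sup>2 - r\<^sup>2) / 2"
  have q: "q > 0" using rs by (simp add: q_def power_strict_mono)
  \<comment> \<open>The ratio of the kernels at \<open>r\<close> and \<open>s\<close> is
    \<open>exp (q / x)\<close>. It decreases in \<open>x\<close> and takes the value
    \<open>A\<close> exactly at \<open>z\<close>, where \<open>W - V\<close> changes sign.\<close>
  define A where "A = exp (q / z)"
  have A: "A > 0" by (simp add: A_def)
  have eq: "normal_kernel r x = exp (q / x) * normal_kernel s x" if "x > 0" for x
  proof -
    have "- (r\<^sup>2 / (2 * x)) = q / x + - (s\<^sup>2 / (2 * x))"
      using that by (simp add: q_def field_simps)
    then have "exp (- (r\<^sup>2 / (2 * x))) = exp (q / x) * exp (- (s\<^sup>2 / (2 * x)))"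
      by (simp only: exp_add)
    then show ?thesis by (simp add: normal_kernel_def)
  qed
  have sgn: "(exp (q / x) - A) * (W x - V x) \<ge> 0" if "x > 0" for x
  proof (cases "x \<in> J")
    case True
    then have "q / z \<le> q / x" using up that q by (intro divide_left_mono) (auto simp: z)
    then have "exp (q / x) \<ge> A" by (simp add: A_def)
    with True show ?thesis by (simp add: J_def)
  next
    case False
    then have "q / x \<le> q / z" using low that q by (intro divide_left_mono) (auto simp: z)
    then have "exp (q / x) \<le> A" by (simp add: A_def)
    with False that show ?thesis by (simp add: J_def mult_nonpos_nonpos)
  qed
  have id: "(normal_kernel r x * W x + A * (normal_kernel s x * V x)) - (normal_kernel r x * V x + A * (normal_kernel s x * W x))
      = normal_kernel s x * ((exp (q / x) - A) * (W x - V x))" if "x > 0" for x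
    unfolding eq[OF that] by (simp add: algebra_simps)
  have "scale_mixture V r + ennreal A * scale_mixture W s < scale_mixture W r + ennreal A * scale_mixture V s"
    unfolding scale_mixture_combination[OF meas(2,1) W V less_imp_le[OF A], simplified]
      scale_mixture_combination[OF meas V W less_imp_le[OF A], simplified]
  proof (rule set_nn_integral_strict_mono)
    fix x :: real assume "x \<in> {0<..}"
    then have x: "x > 0" by simp
    show "0 \<le> normal_kernel r x * V x + A * (normal_kernel s x * W x)"
      using V[OF x] W[OF x] A normal_kernel_pos[OF x] by (simp add: less_imp_le)
    have "0 \<le> normal_kernel s x * ((exp (q / x) - A) * (W x - V x))"
      using sgn[OF x] normal_kernel_pos[OF x, of s] by simp
    then show "normal_kernel r x * V x + A * (normal_kernel s x * W x) \<le> normal_kernel r x * W x + A * (normal_kernel s x * V x)"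
      unfolding id[OF x, symmetric] by simp
  next
    show "(\<integral>\<^sup>+x\<in>{0<..}. ennreal (normal_kernel r x * V x + A * (normal_kernel s x * W x)) \<partial>lborel) < \<infinity>"
      unfolding scale_mixture_combination[OF meas(2,1) W V less_imp_le[OF A], simplified, symmetric]
      using fin by (simp add: ennreal_mult_less_top)
    show "\<not> (AE x in lborel. x \<in> {0<..} \<longrightarrow> normal_kernel r x * V x + A * (normal_kernel s x * W x)
      = normal_kernel r x * W x + A * (normal_kernel s x * V x))"
    proof
      assume "AE x in lborel. x \<in> {0<..} \<longrightarrow> normal_kernel r x * V x + A * (normal_kernel s x * W x)
        = normal_kernel r x * W x + A * (normal_kernel s x * V x)"
      \<comment> \<open>The kernel factor vanishes at \<open>z\<close> only, so off a null set
        equality of the integrands forces \<open>V x = W x\<close>.\<close>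
      moreover have "AE x in lborel. x \<noteq> z" by (rule AE_lborel_singleton)
      ultimately have "AE x in lborel. x > 0 \<longrightarrow> V x = W x"
      proof eventually_elim
        fix x :: real
        assume eq0: "x \<in> {0<..} \<longrightarrow> normal_kernel r x * V x + A * (normal_kernel s x * W x)
            = normal_kernel r x * W x + A * (normal_kernel s x * V x)"
          and xz: "x \<noteq> z"
        show "x > 0 \<longrightarrow> V x = W x"
        proof
          assume x: "x > 0"
          with eq0 have "normal_kernel s x * ((exp (q / x) - A) * (W x - V x)) = 0"
            unfolding id[OF x, symmetric] by simp
          moreover have "exp (q / x) \<noteq> A"
            using q xz x z by (simp add: A_def frac_eq_eq)
          ultimately show "V x = W x" using normal_kernel_pos[OF x, of s] by simp
        qed
      qed
      with ne show False by contradiction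
    qed
  qed measurable
  also have "\<dots> \<le> scale_mixture W r + ennreal A * scale_mixture W s"
    by (intro add_left_mono mult_left_mono le) simp
  finally have "ennreal A * scale_mixture W s + scale_mixture V r < ennreal A * scale_mixture W s + scale_mixture W r"
    by (simp add: ac_simps)
  then show ?thesis
    by (meson add_left_mono not_le)
qed

subsection \<open>Normal variance-mean mixtures\<close>

lemma nn_integral_normal_affine:
  assumes s: "s > 0" and A [measurable]: "A \<in> sets borel"
  shows "(\<integral>\<^sup>+z. ennreal (std_normal_density z) * indicator A (m + s * z) \<partial>lborel)
    = (\<integral>\<^sup>+y. ennreal (exp (- ((y - m)\<^sup>2 / (2 * s\<^sup>2))) / (s * sqrt (2 * pi))) * indicator A y \<partial>lborel)"
proof -
  have "(\<integral>\<^sup>+y. ennreal (exp (- ((y - m)\<^sup>2 / (2 * s\<^sup>2))) / (s * sqrt (2 * pi))) * indicator A y \<partial>lborel)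
    = ennreal \<bar>s\<bar> * (\<integral>\<^sup>+z. ennreal (exp (- ((m + s * z - m)\<^sup>2 / (2 * s\<^sup>2))) / (s * sqrt (2 * pi))) * indicator A (m + s * z) \<partial>lborel)"
    using s by (intro nn_integral_real_affine) auto
  also have "\<dots> = (\<integral>\<^sup>+z. ennreal \<bar>s\<bar> * (ennreal (exp (- ((m + s * z - m)\<^sup>2 / (2 * s\<^sup>2))) / (s * sqrt (2 * pi))) * indicator A (m + s * z)) \<partial>lborel)"
    by (intro nn_integral_cmult[symmetric]) measurable
  also have "\<dots> = (\<integral>\<^sup>+z. ennreal (std_normal_density z) * indicator A (m + s * z) \<partial>lborel)"
  proof (intro nn_integral_cong)
    fix z :: real
    have "\<bar>s\<bar> * (exp (- ((m + s * z - m)\<^sup>2 / (2 * s\<^sup>2))) / (s * sqrt (2 * pi))) = std_normal_density z"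
      using s by (simp add: std_normal_density_def power_mult_distrib)
    then have "ennreal \<bar>s\<bar> * ennreal (exp (- ((m + s * z - m)\<^sup>2 / (2 * s\<^sup>2))) / (s * sqrt (2 * pi))) = ennreal (std_normal_density z)"
      by (metis abs_ge_zero ennreal_mult')
    then show "ennreal \<bar>s\<bar> * (ennreal (exp (- ((m + s * z - m)\<^sup>2 / (2 * s\<^sup>2))) / (s * sqrt (2 * pi))) * indicator A (m + s * z))
        = ennreal (std_normal_density z) * indicator A (m + s * z)"
      by (simp only: mult.assoc[symmetric])
  qed
  finally show ?thesis by simp
qed

text \<open>Given \<open>X = x > 0\<close>, the law is normal with mean
  \<open>\<mu> + \<beta> * x\<close> and standard deviation \<open>\<sigma> * sqrt x\<close>;
  independence and Fubini then integrate this over \<open>g\<close>.\<close>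

lemma distributed_mixture_density:
  fixes M :: "'a measure" and X Y Z :: "'a \<Rightarrow> real"
  assumes M: "prob_space M" and s: "\<sigma> > 0"
    and g_nonneg: "\<And>x. g x \<ge> 0"
    and g_support: "\<And>x. x \<le> 0 \<Longrightarrow> g x = 0"
    and X: "distributed M lborel X (\<lambda>x. ennreal (g x))"
    and Z: "distributed M lborel Z (\<lambda>z. ennreal (std_normal_density z))"
    and indep: "prob_space.indep_var M borel X borel Z"
    and g [measurable]: "g \<in> borel_measurable borel"
  shows "distributed M lborel (\<lambda>\<omega>. \<mu> + \<beta> * X \<omega> + \<sigma> * sqrt (X \<omega>) * Z \<omega>) (mixture_density \<mu> \<beta> \<sigma> g)"
proof -
  interpret prob_space M by fact
  have X_rv [measurable]: "X \<in> borel_measurable M" and Z_rv [measurable]: "Z \<in> borel_measurable M"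
    using distributed_measurable[OF X] distributed_measurable[OF Z] by simp_all
  define h where "h = (\<lambda>(x, z). \<mu> + \<beta> * x + \<sigma> * sqrt x * z)"
  have h [measurable]: "h \<in> borel_measurable (borel \<Otimes>\<^sub>M borel)"
    unfolding h_def by measurable
  have f [measurable]: "mixture_density \<mu> \<beta> \<sigma> g \<in> borel_measurable borel"
    unfolding mixture_density_def[abs_def] by measurable
  have dX: "distr M borel X = density lborel (\<lambda>x. ennreal (g x))"
    using distributed_distr_eq_density[OF X] by (simp cong: distr_cong)
  have dZ: "distr M borel Z = density lborel (\<lambda>z. ennreal (std_normal_density z))"
    using distributed_distr_eq_density[OF Z] by (simp cong: distr_cong)
  interpret PZ: prob_space "distr M borel Z" by (rule prob_space_distr) simp
  have joint: "distr M (borel \<Otimes>\<^sub>M borel) (\<lambda>\<omega>. (X \<omega>, Z \<omega>)) = distr M borel X \<Otimes>\<^sub>M distr M borel Z"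
    using indep unfolding indep_var_distribution_eq by simp
  have "distr M lborel (\<lambda>\<omega>. \<mu> + \<beta> * X \<omega> + \<sigma> * sqrt (X \<omega>) * Z \<omega>) = density lborel (mixture_density \<mu> \<beta> \<sigma> g)"
  proof (rule measure_eqI)
    fix A assume "A \<in> sets (distr M lborel (\<lambda>\<omega>. \<mu> + \<beta> * X \<omega> + \<sigma> * sqrt (X \<omega>) * Z \<omega>))"
    then have A [measurable]: "A \<in> sets borel" by simp
    have "emeasure (distr M lborel (\<lambda>\<omega>. \<mu> + \<beta> * X \<omega> + \<sigma> * sqrt (X \<omega>) * Z \<omega>)) A
      = (\<integral>\<^sup>+\<omega>. indicator A (h (X \<omega>, Z \<omega>)) \<partial>M)"
    proof -
      have "emeasure (distr M lborel (\<lambda>\<omega>. \<mu> + \<beta> * X \<omega> + \<sigma> * sqrt (X \<omega>) * Z \<omega>)) A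
        = (\<integral>\<^sup>+y. indicator A y \<partial>distr M lborel (\<lambda>\<omega>. \<mu> + \<beta> * X \<omega> + \<sigma> * sqrt (X \<omega>) * Z \<omega>))"
        by simp
      also have "\<dots> = (\<integral>\<^sup>+\<omega>. indicator A (h (X \<omega>, Z \<omega>)) \<partial>M)"
        by (subst nn_integral_distr) (simp_all add: h_def)
      finally show ?thesis .
    qed
    also have "\<dots> = (\<integral>\<^sup>+p. indicator A (h p) \<partial>(distr M borel X \<Otimes>\<^sub>M distr M borel Z))"
      unfolding joint[symmetric] by (subst nn_integral_distr) simp_all
    also have "\<dots> = (\<integral>\<^sup>+x. \<integral>\<^sup>+z. indicator A (h (x, z)) \<partial>distr M borel Z \<partial>distr M borel X)"
      by (rule PZ.nn_integral_fst[symmetric]) measurable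
    also have "\<dots> = (\<integral>\<^sup>+x. ennreal (g x) * (\<integral>\<^sup>+z. ennreal (std_normal_density z) * indicator A (h (x, z)) \<partial>lborel) \<partial>lborel)"
      unfolding dX dZ by (simp add: nn_integral_density)
    also have "\<dots> = (\<integral>\<^sup>+x. \<integral>\<^sup>+y. ennreal (1 / (\<sigma> * sqrt (2 * pi * x)) *
        exp (- ((y - \<mu> - \<beta> * x)\<^sup>2 / (2 * \<sigma>\<^sup>2 * x))) * g x) * indicator {0<..} x * indicator A y \<partial>lborel \<partial>lborel)"
    proof (intro nn_integral_cong)
      fix x :: real
      show "ennreal (g x) * (\<integral>\<^sup>+z. ennreal (std_normal_density z) * indicator A (h (x, z)) \<partial>lborel)
        = (\<integral>\<^sup>+y. ennreal (1 / (\<sigma> * sqrt (2 * pi * x)) *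
        exp (- ((y - \<mu> - \<beta> * x)\<^sup>2 / (2 * \<sigma>\<^sup>2 * x))) * g x) * indicator {0<..} x * indicator A y \<partial>lborel)"
      proof (cases "x > 0")
        case True
        have pos: "\<sigma> * sqrt x > 0" using s True by simp
        have "ennreal (g x) * (\<integral>\<^sup>+z. ennreal (std_normal_density z) * indicator A (h (x, z)) \<partial>lborel)
          = ennreal (g x) * (\<integral>\<^sup>+y. ennreal (exp (- ((y - (\<mu> + \<beta> * x))\<^sup>2 / (2 * (\<sigma> * sqrt x)\<^sup>2))) / ((\<sigma> * sqrt x) * sqrt (2 * pi))) * indicator A y \<partial>lborel)"
          using nn_integral_normal_affine[OF pos A, of "\<mu> + \<beta> * x"] by (simp add: h_def)
        also have "\<dots> = (\<integral>\<^sup>+y. ennreal (g x) * (ennreal (exp (- ((y - (\<mu> + \<beta> * x))\<^sup>2 / (2 * (\<sigma> * sqrt x)\<^sup>2))) / ((\<sigma> * sqrt x) * sqrt (2 * pi))) * indicator A y) \<partial>lborel)"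
          by (intro nn_integral_cmult[symmetric]) measurable
        also have "\<dots> = (\<integral>\<^sup>+y. ennreal (1 / (\<sigma> * sqrt (2 * pi * x)) *
          exp (- ((y - \<mu> - \<beta> * x)\<^sup>2 / (2 * \<sigma>\<^sup>2 * x))) * g x) * indicator {0<..} x * indicator A y \<partial>lborel)"
        proof (intro nn_integral_cong)
          fix y :: real
          have "sqrt (2 * pi * x) = sqrt (2 * pi) * sqrt x" by (rule real_sqrt_mult)
          then have "g x * (exp (- ((y - (\<mu> + \<beta> * x))\<^sup>2 / (2 * (\<sigma> * sqrt x)\<^sup>2))) / ((\<sigma> * sqrt x) * sqrt (2 * pi)))
            = 1 / (\<sigma> * sqrt (2 * pi * x)) * exp (- ((y - \<mu> - \<beta> * x)\<^sup>2 / (2 * \<sigma>\<^sup>2 * x))) * g x"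
            using True by (simp add: power_mult_distrib diff_diff_eq mult_ac)
          then have "ennreal (g x) * ennreal (exp (- ((y - (\<mu> + \<beta> * x))\<^sup>2 / (2 * (\<sigma> * sqrt x)\<^sup>2))) / ((\<sigma> * sqrt x) * sqrt (2 * pi)))
            = ennreal (1 / (\<sigma> * sqrt (2 * pi * x)) * exp (- ((y - \<mu> - \<beta> * x)\<^sup>2 / (2 * \<sigma>\<^sup>2 * x))) * g x)"
            by (metis ennreal_mult' g_nonneg)
          then show "ennreal (g x) * (ennreal (exp (- ((y - (\<mu> + \<beta> * x))\<^sup>2 / (2 * (\<sigma> * sqrt x)\<^sup>2))) / ((\<sigma> * sqrt x) * sqrt (2 * pi))) * indicator A y)
            = ennreal (1 / (\<sigma> * sqrt (2 * pi * x)) * exp (- ((y - \<mu> - \<beta> * x)\<^sup>2 / (2 * \<sigma>\<^sup>2 * x))) * g x) * indicator {0<..} x * indicator A y"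
            using True by (simp only: mult.assoc[symmetric] indicator_simps greaterThan_iff mult_1_right)
        qed
        finally show ?thesis .
      qed (simp add: g_support)
    qed
    also have "\<dots> = (\<integral>\<^sup>+y. \<integral>\<^sup>+x. ennreal (1 / (\<sigma> * sqrt (2 * pi * x)) *
        exp (- ((y - \<mu> - \<beta> * x)\<^sup>2 / (2 * \<sigma>\<^sup>2 * x))) * g x) * indicator {0<..} x * indicator A y \<partial>lborel \<partial>lborel)"
      by (rule lborel_pair.Fubini') measurable
    also have "\<dots> = (\<integral>\<^sup>+y. mixture_density \<mu> \<beta> \<sigma> g y * indicator A y \<partial>lborel)"
      unfolding mixture_density_def by (intro nn_integral_cong nn_integral_multc) measurable
    also have "\<dots> = emeasure (density lborel (mixture_density \<mu> \<beta> \<sigma> g)) A"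
      by (simp add: emeasure_density)
    finally show "emeasure (distr M lborel (\<lambda>\<omega>. \<mu> + \<beta> * X \<omega> + \<sigma> * sqrt (X \<omega>) * Z \<omega>)) A
      = emeasure (density lborel (mixture_density \<mu> \<beta> \<sigma> g)) A" .
  qed simp
  then show ?thesis
    unfolding distributed_def by simp
qed

definition mixture :: "real \<Rightarrow> (real \<Rightarrow> real) \<Rightarrow> real \<Rightarrow> ennreal" where
  "mixture b g t = ennreal (exp (b * t)) * scale_mixture (\<lambda>x. exp (- (b\<^sup>2 * x / 2)) * g x) t"

lemma mixture_density_eq:
  assumes s: "\<sigma> > 0" and [measurable]: "g \<in> borel_measurable borel" and g: "\<And>x. g x \<ge> 0"
  shows "mixture_density \<mu> \<beta> \<sigma> g y = ennreal (1 / \<sigma>) * mixture (\<beta> / \<sigma>) g ((y - \<mu>) / \<sigma>)"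
proof -
  define b t where "b = \<beta> / \<sigma>" and "t = (y - \<mu>) / \<sigma>"
  have bt: "\<beta> = \<sigma> * b" "y - \<mu> = \<sigma> * t" using s by (simp_all add: b_def t_def)
  have "mixture_density \<mu> \<beta> \<sigma> g y = (\<integral>\<^sup>+x. ennreal (1 / \<sigma>) * (ennreal (exp (b * t)) *
      (ennreal (normal_kernel t x * (exp (- (b\<^sup>2 * x / 2)) * g x)) * indicator {0<..} x)) \<partial>lborel)"
    unfolding mixture_density_def
  proof (intro nn_integral_cong)
    fix x :: real
    show "ennreal (1 / (\<sigma> * sqrt (2 * pi * x)) * exp (- ((y - \<mu> - \<beta> * x)\<^sup>2 / (2 * \<sigma>\<^sup>2 * x))) * g x) * indicator {0<..} x
      = ennreal (1 / \<sigma>) * (ennreal (exp (b * t)) *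
      (ennreal (normal_kernel t x * (exp (- (b\<^sup>2 * x / 2)) * g x)) * indicator {0<..} x))"
    proof (cases "x > 0")
      case True
      have "(y - \<mu> - \<beta> * x)\<^sup>2 / (2 * \<sigma>\<^sup>2 * x) = (\<sigma> * (t - b * x))\<^sup>2 / (2 * \<sigma>\<^sup>2 * x)"
        unfolding bt by (simp add: algebra_simps)
      also have "\<dots> = (t - b * x)\<^sup>2 / (2 * x)"
        using s by (simp add: power_mult_distrib)
      also have "\<dots> = t\<^sup>2 / (2 * x) + b\<^sup>2 * x / 2 - b * t"
        using True by (simp add: power2_eq_square field_simps)
      finally have "- ((y - \<mu> - \<beta> * x)\<^sup>2 / (2 * \<sigma>\<^sup>2 * x)) = b * t + (- (t\<^sup>2 / (2 * x)) + - (b\<^sup>2 * x / 2))"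
        by simp
      then have "exp (- ((y - \<mu> - \<beta> * x)\<^sup>2 / (2 * \<sigma>\<^sup>2 * x)))
        = exp (b * t) * (exp (- (t\<^sup>2 / (2 * x))) * exp (- (b\<^sup>2 * x / 2)))"
        by (simp only: exp_add)
      then have "1 / (\<sigma> * sqrt (2 * pi * x)) * exp (- ((y - \<mu> - \<beta> * x)\<^sup>2 / (2 * \<sigma>\<^sup>2 * x))) * g x
        = 1 / \<sigma> * (exp (b * t) * (normal_kernel t x * (exp (- (b\<^sup>2 * x / 2)) * g x)))"
        by (simp add: exp_add normal_kernel_def)
      moreover have "ennreal (1 / \<sigma> * (exp (b * t) * k)) = ennreal (1 / \<sigma>) * (ennreal (exp (b * t)) * ennreal k)" for k
        using s by (simp add: ennreal_mult'[symmetric])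
      ultimately show ?thesis
        using True by (simp only: indicator_simps greaterThan_iff mult_1_right)
    qed simp
  qed
  also have "\<dots> = ennreal (1 / \<sigma>) * mixture b g t"
    unfolding mixture_def scale_mixture_def by (simp add: nn_integral_cmult)
  finally show ?thesis by (simp add: b_def t_def)
qed

text \<open>The tilt depends on \<open>b\<close> only through its square and the scale mixture is
  even, so reflection merely flips the drift.\<close>

lemma mixture_uminus: "mixture b g (- t) = mixture (- b) g t"
  by (simp add: mixture_def scale_mixture_uminus)

lemma (in mixing_weight) mixing_weight_tilt:
  "mixing_weight (\<lambda>x. exp (- (b\<^sup>2 * x / 2)) * W x)"
proof
  show "(\<lambda>x. exp (- (b\<^sup>2 * x / 2)) * W x) \<in> borel_measurable borel" by measurable
  show "x > 0 \<Longrightarrow> exp (- (b\<^sup>2 * x / 2)) * W x \<ge> 0" for x using nonneg by simp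
  have "(\<integral>\<^sup>+x\<in>{0<..}. ennreal (exp (- (b\<^sup>2 * x / 2)) * W x) \<partial>lborel) \<le> (\<integral>\<^sup>+x\<in>{0<..}. ennreal (W x) \<partial>lborel)"
    using nonneg by (intro nn_integral_mono) (auto simp: indicator_def intro!: ennreal_leI mult_left_le_one_le)
  also have "\<dots> < \<infinity>" by (rule finite_mass)
  finally show "(\<integral>\<^sup>+x\<in>{0<..}. ennreal (exp (- (b\<^sup>2 * x / 2)) * W x) \<partial>lborel) < \<infinity>" .
  show "\<not> (AE x in lborel. x > 0 \<longrightarrow> exp (- (b\<^sup>2 * x / 2)) * W x = 0)"
    using not_null by simp
qed

text \<open>Turns a comparison of \<open>mixture b W\<close> with a constant into one of a scale
  mixture with an exponential.\<close>

lemma ennreal_le_exp_mult_iff: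
  assumes "c \<ge> 0"
  shows "ennreal c \<le> ennreal (exp z) * p \<longleftrightarrow> ennreal (c * exp (- z)) \<le> p"
proof -
  have "ennreal c = ennreal (exp z) * ennreal (c * exp (- z))"
    using assms by (simp add: ennreal_mult'[symmetric] mult.left_commute mult_exp_exp)
  then show ?thesis
    by (simp add: ennreal_mult_le_mult_iff)
qed

lemma ennreal_less_exp_mult_iff:
  assumes "c \<ge> 0"
  shows "ennreal c < ennreal (exp z) * p \<longleftrightarrow> ennreal (c * exp (- z)) < p"
proof -
  have "ennreal c = ennreal (exp z) * ennreal (c * exp (- z))"
    using assms by (simp add: ennreal_mult'[symmetric] mult.left_commute mult_exp_exp)
  then have "ennreal (exp z) * p \<le> ennreal c \<longleftrightarrow> p \<le> ennreal (c * exp (- z))"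
    by (simp add: ennreal_mult_le_mult_iff)
  then show ?thesis by (meson not_less)
qed

subsection \<open>Unimodality\<close>

text \<open>Quasi-concavity alone also admits strictly monotone functions; an attained maximum
  excludes them and, placed at one end of the triple, turns the minimum into the value at the other
  end.\<close>

lemma is_modeI_quasiconcave:
  assumes q: "\<And>r s t. r < s \<Longrightarrow> s < t \<Longrightarrow> min (F r) (F t) \<le> F s"
    and m: "\<And>x. F x \<le> F m"
  shows "is_mode F m"
  unfolding is_mode_def
proof (intro conjI monotone_onI)
  fix x y assume "x \<in> {..m}" "y \<in> {..m}" "x \<le> y"
  then show "F x \<le> F y"
    using q[of x y m] m[of x] by (cases "x = y \<or> y = m") auto
next
  fix x y assume "x \<in> {m..}" "y \<in> {m..}" "x \<le> y"
  then show "F x \<ge> F y"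
    using q[of m x y] m[of y] by (cases "x = y \<or> x = m") (auto simp: min_def split: if_splits)
qed

lemma is_mode_strict_iff:
  fixes F :: "real \<Rightarrow> 'a :: linorder"
  assumes up: "\<And>r s. r < s \<Longrightarrow> s \<le> m0 \<Longrightarrow> F r < F s"
    and down: "\<And>r s. m0 \<le> r \<Longrightarrow> r < s \<Longrightarrow> F s < F r"
  shows "is_mode F m \<longleftrightarrow> m = m0"
proof
  assume m: "is_mode F m"
  show "m = m0"
  proof (rule linorder_cases[of m m0])
    assume less: "m < m0"
    then have "F m0 \<le> F m"
      using m by (auto simp: is_mode_def monotone_on_def)
    with up[of m m0] less show ?thesis by simp
  next
    assume less: "m0 < m"
    then have "F m0 \<le> F m"
      using m by (auto simp: is_mode_def monotone_on_def)
    with down[of m0 m] less show ?thesis by simp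
  qed
next
  assume "m = m0"
  have "F r \<le> F s" if "r \<le> s" "s \<le> m0" for r s
    using up[of r s] that by (cases "r = s") auto
  moreover have "F s \<le> F r" if "m0 \<le> r" "r \<le> s" for r s
    using down[of r s] that by (cases "r = s") auto
  ultimately show "is_mode F m"
    using \<open>m = m0\<close> by (auto simp: is_mode_def monotone_on_def)
qed

lemma is_mode_uminus:
  fixes F :: "real \<Rightarrow> 'a :: linorder"
  shows "is_mode (\<lambda>t. F (- t)) m \<longleftrightarrow> is_mode F (- m)"
proof -
  have *: "is_mode (\<lambda>t. F (- t)) (- m)" if "is_mode F m" for F :: "real \<Rightarrow> 'a" and m
    unfolding is_mode_def
  proof (intro conjI monotone_onI)
    fix x y assume "x \<in> {..- m}" "y \<in> {..- m}" "x \<le> y"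
    then show "F (- x) \<le> F (- y)" using that by (auto simp: is_mode_def monotone_on_def)
  next
    fix x y assume "x \<in> {- m..}" "y \<in> {- m..}" "x \<le> y"
    then show "F (- x) \<ge> F (- y)" using that by (auto simp: is_mode_def monotone_on_def)
  qed
  show ?thesis
    using *[of F "- m"] *[of "\<lambda>t. F (- t)" m] by auto
qed

lemma is_mode_affine:
  fixes F :: "real \<Rightarrow> ennreal"
  assumes s: "\<sigma> > 0" and f: "\<And>y. f y = ennreal (1 / \<sigma>) * F ((y - \<mu>) / \<sigma>)"
  shows "is_mode f m \<longleftrightarrow> is_mode F ((m - \<mu>) / \<sigma>)"
proof -
  have le: "f x \<le> f y \<longleftrightarrow> F ((x - \<mu>) / \<sigma>) \<le> F ((y - \<mu>) / \<sigma>)" for x y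
    unfolding f using s by (intro ennreal_mult_le_mult_iff) auto
  have le': "F x \<le> F y \<longleftrightarrow> f (\<mu> + \<sigma> * x) \<le> f (\<mu> + \<sigma> * y)" for x y
    using s by (simp add: le)
  have m: "\<mu> + \<sigma> * x \<le> m \<longleftrightarrow> x \<le> (m - \<mu>) / \<sigma>" "m \<le> \<mu> + \<sigma> * x \<longleftrightarrow> (m - \<mu>) / \<sigma> \<le> x" for x
    using s by (auto simp: field_simps)
  show ?thesis
  proof
    assume *: "is_mode f m"
    show "is_mode F ((m - \<mu>) / \<sigma>)"
      unfolding is_mode_def
    proof (intro conjI monotone_onI)
      fix x y assume "x \<in> {..(m - \<mu>) / \<sigma>}" "y \<in> {..(m - \<mu>) / \<sigma>}" "x \<le> y"
      then show "F x \<le> F y"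
        unfolding le' using * s m by (auto simp: is_mode_def monotone_on_def)
    next
      fix x y assume "x \<in> {(m - \<mu>) / \<sigma>..}" "y \<in> {(m - \<mu>) / \<sigma>..}" "x \<le> y"
      then show "F x \<ge> F y"
        unfolding le' using * s m by (auto simp: is_mode_def monotone_on_def)
    qed
  next
    assume *: "is_mode F ((m - \<mu>) / \<sigma>)"
    show "is_mode f m"
      unfolding is_mode_def
    proof (intro conjI monotone_onI)
      fix x y assume "x \<in> {..m}" "y \<in> {..m}" "x \<le> y"
      then show "f x \<le> f y"
        unfolding le using * s by (auto simp: is_mode_def monotone_on_def divide_right_mono)
    next
      fix x y assume "x \<in> {m..}" "y \<in> {m..}" "x \<le> y"
      then show "f x \<ge> f y"
        unfolding le using * s by (auto simp: is_mode_def monotone_on_def divide_right_mono)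
    qed
  qed
qed

lemma unimodal_pos_interval:
  assumes "unimodal_pos g"
  shows "is_interval {x. 0 < x \<and> k < g x}"
  unfolding is_interval_1
proof (intro ballI allI impI)
  fix a b x :: real
  assume ab: "a \<in> {x. 0 < x \<and> k < g x}" "b \<in> {x. 0 < x \<and> k < g x}" and x: "a \<le> x \<and> x \<le> b"
  obtain m where m: "mono_on {0<..m} g" "antimono_on ({m..} \<inter> {0<..}) g"
    using assms by (auto simp: unimodal_pos_def)
  have "g a \<le> g x \<or> g b \<le> g x"
  proof (cases "x \<le> m")
    case True
    then have "g a \<le> g x" using monotone_onD[OF m(1), of a x] ab x by auto
    then show ?thesis ..
  next
    case False
    then have "g b \<le> g x" using monotone_onD[OF m(2), of x b] ab x by auto
    then show ?thesis ..
  qed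
  with ab x show "x \<in> {x. 0 < x \<and> k < g x}" by auto
qed

lemma emeasure_lborel_Ioi: "emeasure lborel {a::real<..} = \<infinity>"
proof (rule ccontr)
  assume "emeasure lborel {a<..} \<noteq> \<infinity>"
  then obtain r where r: "r \<ge> 0" "emeasure lborel {a<..} = ennreal r"
    by (metis ennreal_cases infinity_ennreal_def)
  have "emeasure lborel {a<..a + (r + 1)} \<le> emeasure lborel {a<..}"
    by (intro emeasure_mono) auto
  then have "ennreal (r + 1) \<le> ennreal r" using r by simp
  then show False using r by (simp add: ennreal_le_iff)
qed

context mixing_weight
begin

text \<open>Both factors of the mixture increase left of 0; the strictness comes from the scale
  mixture, as \<open>b\<close> may be 0.\<close>

lemma mixture_strict_mono_nonpos:
  assumes "b \<ge> 0" "r < s" "s \<le> 0"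
  shows "mixture b W r < mixture b W s"
proof -
  interpret T: mixing_weight "\<lambda>x. exp (- (b\<^sup>2 * x / 2)) * W x" by (rule mixing_weight_tilt)
  let ?S = "scale_mixture (\<lambda>x. exp (- (b\<^sup>2 * x / 2)) * W x)"
  have "?S (- r) < ?S (- s)" using assms by (intro T.scale_mixture_strict_antimono) auto
  then have less: "?S r < ?S s" by (simp add: scale_mixture_uminus)
  have "mixture b W r \<le> ennreal (exp (b * s)) * ?S r"
    unfolding mixture_def using assms by (intro mult_right_mono) (auto intro!: ennreal_leI mult_left_mono)
  also have "\<dots> < mixture b W s"
    unfolding mixture_def using less by (intro ennreal_mult_strict_left_mono) auto
  finally show ?thesis .
qed

lemma mixture_pos: "0 < mixture b W t"
proof -
  interpret T: mixing_weight "\<lambda>x. exp (- (b\<^sup>2 * x / 2)) * W x" by (rule mixing_weight_tilt)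
  show ?thesis
    unfolding mixture_def using T.scale_mixture_pos[of t] by (simp add: ennreal_zero_less_mult_iff)
qed

lemma mixture_finite: "t \<noteq> 0 \<Longrightarrow> mixture b W t < \<infinity>"
proof -
  interpret T: mixing_weight "\<lambda>x. exp (- (b\<^sup>2 * x / 2)) * W x" by (rule mixing_weight_tilt)
  assume "t \<noteq> 0"
  then show ?thesis
    unfolding mixture_def using T.scale_mixture_finite[of t] by (simp add: ennreal_mult_less_top)
qed

text \<open>For \<open>b > 0\<close> the function \<open>x \<mapsto> c b exp (- b\<^sup>2 x / 2)\<close> is the tilted mixing weight of a
  constant, and its mixture is the constant \<open>c\<close> on the positive half-line.\<close>

lemma mixture_quasiconcave_nonneg:
  assumes b: "b > 0" and uni: "unimodal_pos W" and rst: "0 \<le> r" "r < s" "s < t"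
  shows "min (mixture b W r) (mixture b W t) \<le> mixture b W s"
proof -
  interpret T: mixing_weight "\<lambda>x. exp (- (b\<^sup>2 * x / 2)) * W x" by (rule mixing_weight_tilt)
  \<comment> \<open>The level to be kept at \<open>s\<close>. It is finite since the value at
    \<open>t > 0\<close> is, even if the one at \<open>r = 0\<close> is infinite.\<close>
  define c where "c = enn2real (min (mixture b W r) (mixture b W t))"
  have fin: "min (mixture b W r) (mixture b W t) < \<infinity>"
    using mixture_finite[of t b] rst by (simp add: min_less_iff_disj)
  have c: "ennreal c = min (mixture b W r) (mixture b W t)"
    unfolding c_def using fin by (simp add: less_top[symmetric])
  have "0 < ennreal c" unfolding c using mixture_pos by simp
  then have c0: "c > 0" by simp
  define V where "V x = c * b * exp (- (b\<^sup>2 * x / 2))" for x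
  have V: "scale_mixture V u = ennreal (c * exp (- (b * u)))" if "u \<ge> 0" for u
    using scale_mixture_exp_cmult[OF b c0 that] by (simp add: V_def[abs_def])
  have iff: "ennreal c \<le> mixture b W u \<longleftrightarrow> scale_mixture V u \<le> scale_mixture (\<lambda>x. exp (- (b\<^sup>2 * x / 2)) * W x) u"
    if "u \<ge> 0" for u
    unfolding V[OF that] mixture_def using c0 by (intro ennreal_le_exp_mult_iff) simp
  have "scale_mixture V s \<le> scale_mixture (\<lambda>x. exp (- (b\<^sup>2 * x / 2)) * W x) s"
  proof (rule scale_mixture_compare[OF _ T.meas _ T.nonneg rst])
    show "V \<in> borel_measurable borel" unfolding V_def[abs_def] by measurable
    show "0 \<le> V x" if "x > 0" for x using b c0 by (simp add: V_def)
    \<comment> \<open>The tilt is common to both sides, which leaves a superlevel set of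
      \<open>W\<close> itself.\<close>
    have "V x < exp (- (b\<^sup>2 * x / 2)) * W x \<longleftrightarrow> c * b < W x" for x
      by (simp add: V_def mult.commute[of _ "exp (- (b\<^sup>2 * x / 2))"])
    then show "is_interval {x. 0 < x \<and> V x < exp (- (b\<^sup>2 * x / 2)) * W x}"
      using unimodal_pos_interval[OF uni] by simp
    show "scale_mixture V r \<le> scale_mixture (\<lambda>x. exp (- (b\<^sup>2 * x / 2)) * W x) r"
      using iff[of r] rst c by simp
    show "scale_mixture V t \<le> scale_mixture (\<lambda>x. exp (- (b\<^sup>2 * x / 2)) * W x) t"
      using iff[of t] rst c by simp
  qed (use V rst in auto)
  then show ?thesis using iff[of s] rst c by simp
qed

text \<open>Quasi-concavity extends to the whole line because the mixture increases up to 0. The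
  point \<open>z\<close> confines the search for a maximum to \<open>{0..z}\<close>, where
  continuity provides one; an infinite value at 0 is a maximum already.\<close>

lemma mixture_unimodal_pos_drift:
  assumes b: "b > 0" and uni: "unimodal_pos W"
    and z: "z > 0" "mixture b W z < mixture b W 0"
  shows "unimodal (mixture b W)"
proof -
  interpret T: mixing_weight "\<lambda>x. exp (- (b\<^sup>2 * x / 2)) * W x" by (rule mixing_weight_tilt)
  have up: "mixture b W r \<le> mixture b W s" if "r \<le> s" "s \<le> 0" for r s
    using mixture_strict_mono_nonpos[of b r s] that b by (cases "r = s") auto
  have q: "min (mixture b W r) (mixture b W t) \<le> mixture b W s" if rst: "r < s" "s < t" for r s t
  proof (cases "s \<le> 0")
    case True
    with up[of r s] rst show ?thesis by (simp add: min.coboundedI1)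
  next
    case False
    show ?thesis
    proof (cases "r \<ge> 0")
      case True
      with mixture_quasiconcave_nonneg[OF b uni, of r s t] rst show ?thesis by simp
    next
      case r: False
      have "min (mixture b W r) (mixture b W t) \<le> min (mixture b W 0) (mixture b W t)"
        using up[of r 0] r by (intro min.mono) auto
      also have "\<dots> \<le> mixture b W s"
        using mixture_quasiconcave_nonneg[OF b uni, of 0 s t] rst False by simp
      finally show ?thesis .
    qed
  qed
  have "\<exists>m. \<forall>x. mixture b W x \<le> mixture b W m"
  proof (cases "mixture b W 0 < \<infinity>")
    case False
    then show ?thesis by (metis infinity_ennreal_def less_top top_greatest)
  next
    case True
    then have fin: "scale_mixture (\<lambda>x. exp (- (b\<^sup>2 * x / 2)) * W x) 0 < \<infinity>"
      by (simp add: mixture_def)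
    have "continuous_on {0..} (mixture b W)"
      unfolding continuous_on_def
    proof
      fix t :: real assume t: "t \<in> {0..}"
      have "((\<lambda>t. scale_mixture (\<lambda>x. exp (- (b\<^sup>2 * x / 2)) * W x) t) \<longlongrightarrow> scale_mixture (\<lambda>x. exp (- (b\<^sup>2 * x / 2)) * W x) t) (at t within {0..})"
        using T.scale_mixture_continuous_on[OF fin] t by (auto simp: continuous_on_def)
      moreover have "((\<lambda>t. ennreal (exp (b * t))) \<longlongrightarrow> ennreal (exp (b * t))) (at t within {0..})"
        by (intro tendsto_intros)
      ultimately show "(mixture b W \<longlongrightarrow> mixture b W t) (at t within {0..})"
        unfolding mixture_def[abs_def] by (intro tendsto_mult_ennreal) auto
    qed
    then have "continuous_on {0..z} (mixture b W)" by (rule continuous_on_subset) auto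
    then obtain m where m: "m \<in> {0..z}" "\<And>x. x \<in> {0..z} \<Longrightarrow> mixture b W x \<le> mixture b W m"
      using continuous_attains_sup[of "{0..z}" "mixture b W"] z by auto
    have "mixture b W x \<le> mixture b W m" for x
    proof -
      consider "x < 0" | "x \<in> {0..z}" | "x > z" by force
      then show ?thesis
      proof cases
        case 1
        then have "mixture b W x \<le> mixture b W 0" by (intro up) auto
        also have "\<dots> \<le> mixture b W m" using z by (intro m) auto
        finally show ?thesis .
      next
        case 2
        then show ?thesis by (rule m)
      next
        case 3
        \<comment> \<open>Quasi-concavity at \<open>0 < z < x\<close>: the value at \<open>z\<close>
          is below that at 0, so the minimum must be the value at \<open>x\<close>.\<close>
        then have "mixture b W x \<le> mixture b W z"
          using q[of 0 z x] z by (auto simp: min_def split: if_splits)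
        also have "\<dots> \<le> mixture b W m" using z by (intro m) auto
        finally show ?thesis .
      qed
    qed
    then show ?thesis by blast
  qed
  then obtain m where "\<And>x. mixture b W x \<le> mixture b W m" by blast
  with q have "is_mode (mixture b W) m" by (intro is_modeI_quasiconcave)
  then show ?thesis by (auto simp: unimodal_def)
qed

text \<open>Provides a point where a decreasing weight has fallen to a given level, and excludes a
  weight that is almost everywhere equal to a positive constant.\<close>

lemma not_bounded_below:
  assumes "k > 0"
  shows "\<not> (AE x in lborel. x > 0 \<longrightarrow> k \<le> W x)"
proof
  assume "AE x in lborel. x > 0 \<longrightarrow> k \<le> W x"
  then have "AE x::real in lborel. ennreal k * indicator {0<..} x \<le> ennreal (W x) * indicator {0<..} x"
    by eventually_elim (simp add: indicator_def ennreal_leI)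
  then have "(\<integral>\<^sup>+x. ennreal k * indicator {0::real<..} x \<partial>lborel) \<le> (\<integral>\<^sup>+x\<in>{0<..}. ennreal (W x) \<partial>lborel)"
    by (rule nn_integral_mono_AE)
  moreover have "(\<integral>\<^sup>+x. ennreal k * indicator {0::real<..} x \<partial>lborel) = \<infinity>"
    using assms by (simp add: nn_integral_cmult_indicator emeasure_lborel_Ioi ennreal_mult_top)
  ultimately show False using finite_mass by simp
qed

text \<open>For \<open>b > 0\<close> the mixture is compared with the constant \<open>c\<close> that
  it attains at \<open>s\<close>. The superlevel set of a decreasing \<open>W\<close> is an initial
  segment, so there is one sign change, and the value at \<open>r\<close> strictly exceeds
  \<open>c\<close>.\<close>

lemma mixture_strict_antimono_nonneg:
  assumes b: "b \<ge> 0" and dec: "antimono_on {0<..} W \<or> b = 0" and rs: "0 \<le> r" "r < s"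
  shows "mixture b W s < mixture b W r"
proof (cases "b = 0")
  case True
  then show ?thesis
    using scale_mixture_strict_antimono[OF rs] by (simp add: mixture_def)
next
  case False
  then have b: "b > 0" and dec: "antimono_on {0<..} W" using assms by auto
  interpret T: mixing_weight "\<lambda>x. exp (- (b\<^sup>2 * x / 2)) * W x" by (rule mixing_weight_tilt)
  define c where "c = enn2real (mixture b W s)"
  have c: "ennreal c = mixture b W s"
    unfolding c_def using mixture_finite[of s b] rs by (simp add: less_top[symmetric])
  have "0 < ennreal c" unfolding c by (rule mixture_pos)
  then have c0: "c > 0" by simp
  define V where "V x = c * b * exp (- (b\<^sup>2 * x / 2))" for x
  have V: "scale_mixture V u = ennreal (c * exp (- (b * u)))" if "u \<ge> 0" for u
    using scale_mixture_exp_cmult[OF b c0 that] by (simp add: V_def[abs_def])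
  have less: "V x < exp (- (b\<^sup>2 * x / 2)) * W x \<longleftrightarrow> c * b < W x" for x
    by (simp add: V_def mult.commute[of _ "exp (- (b\<^sup>2 * x / 2))"])
  have "\<exists>K>0. W K \<le> c * b"
  proof (rule ccontr)
    assume "\<not> (\<exists>K>0. W K \<le> c * b)"
    then have "AE x in lborel. x > 0 \<longrightarrow> c * b \<le> W x" by (intro AE_I2) force
    then show False using not_bounded_below[of "c * b"] b c0 by simp
  qed
  then obtain K where K: "K > 0" "W K \<le> c * b" by blast
  have "scale_mixture V r < scale_mixture (\<lambda>x. exp (- (b\<^sup>2 * x / 2)) * W x) r"
  proof (rule scale_mixture_compare_initial[OF _ T.meas _ T.nonneg rs, where K = K])
    show "V \<in> borel_measurable borel" unfolding V_def[abs_def] by measurable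
    show "0 \<le> V x" if "x > 0" for x using b c0 by (simp add: V_def)
    fix x y :: real
    show "V x < exp (- (b\<^sup>2 * x / 2)) * W x" if "0 < x" "x \<le> y" "V y < exp (- (b\<^sup>2 * y / 2)) * W y"
      using that monotone_onD[OF dec, of x y] unfolding less by auto
    show "x \<le> K" if "0 < x" "V x < exp (- (b\<^sup>2 * x / 2)) * W x"
    proof (rule ccontr)
      assume "\<not> x \<le> K"
      then have "W x \<le> W K" using monotone_onD[OF dec, of K x] K by auto
      with that K show False unfolding less by simp
    qed
  next
    show "\<not> (AE x in lborel. x > 0 \<longrightarrow> V x = exp (- (b\<^sup>2 * x / 2)) * W x)"
    proof
      assume "AE x in lborel. x > 0 \<longrightarrow> V x = exp (- (b\<^sup>2 * x / 2)) * W x"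
      then have "AE x in lborel. x > 0 \<longrightarrow> c * b \<le> W x"
        by eventually_elim (simp add: V_def)
      then show False using not_bounded_below[of "c * b"] b c0 by simp
    qed
    have "ennreal c \<le> mixture b W s" by (simp add: c)
    then show "scale_mixture V s \<le> scale_mixture (\<lambda>x. exp (- (b\<^sup>2 * x / 2)) * W x) s"
      using rs c0 by (simp add: V mixture_def ennreal_le_exp_mult_iff)
    show "scale_mixture (\<lambda>x. exp (- (b\<^sup>2 * x / 2)) * W x) s < \<infinity>"
      using rs by (intro T.scale_mixture_finite) simp
  qed (use V rs in auto)
  then have "ennreal c < mixture b W r"
    using rs c0 by (simp add: V mixture_def ennreal_less_exp_mult_iff)
  then show ?thesis by (simp add: c)
qed

lemma is_mode_mixture_iff:
  assumes "antimono_on {0<..} W \<or> b = 0"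
  shows "is_mode (mixture b W) m \<longleftrightarrow> m = 0"
proof (cases "b \<ge> 0")
  case True
  with assms show ?thesis
    by (intro is_mode_strict_iff mixture_strict_mono_nonpos mixture_strict_antimono_nonneg) auto
next
  case False
  have "is_mode (mixture (- b) W) m \<longleftrightarrow> m = 0" for m
    using False assms
    by (intro is_mode_strict_iff mixture_strict_mono_nonpos mixture_strict_antimono_nonneg) auto
  then show ?thesis
    using is_mode_uminus[of "mixture b W" "- m"] by (simp add: mixture_uminus[abs_def])
qed

end

subsection \<open>Log-concavity and log-convexity\<close>

text \<open>The chord of the log-mixture between \<open>r\<close> and \<open>t\<close> is itself the
  logarithm of the mixture of an exponential weight.\<close>

lemma (in mixing_weight) log_interpolation:
  assumes rst: "0 \<le> r" "r < s" "s < t" and fin: "scale_mixture W r < \<infinity>"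
  defines "L \<equiv> \<lambda>u. ln (enn2real (scale_mixture W u))"
  obtains a c where "a > 0" "c > 0"
    "scale_mixture (\<lambda>x. c * a * exp (- (a\<^sup>2 * x / 2))) r = scale_mixture W r"
    "scale_mixture (\<lambda>x. c * a * exp (- (a\<^sup>2 * x / 2))) t = scale_mixture W t"
    "scale_mixture (\<lambda>x. c * a * exp (- (a\<^sup>2 * x / 2))) s = ennreal (exp (((t - s) * L r + (s - r) * L t) / (t - r)))"
proof -
  have L: "scale_mixture W u = ennreal (exp (L u))" if "scale_mixture W u < \<infinity>" for u
    using that scale_mixture_pos[of u] unfolding L_def
    by (metis enn2real_positive_iff ennreal_enn2real exp_ln infinity_ennreal_def)
  have fint: "scale_mixture W t < \<infinity>" using rst by (intro scale_mixture_finite) simp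
  have "ennreal (exp (L t)) < ennreal (exp (L r))"
    using scale_mixture_strict_antimono[of r t] rst L[OF fin] L[OF fint] by simp
  then have Lrt: "L t < L r" by (simp add: ennreal_less_iff)
  \<comment> \<open>Minus the slope of the chord, positive since the mixture is strictly decreasing,
    and the exponential of its value at 0.\<close>
  define a c where "a = (L r - L t) / (t - r)" and "c = exp (L r + a * r)"
  have a: "a > 0" using Lrt rst by (simp add: a_def)
  have val: "scale_mixture (\<lambda>x. c * a * exp (- (a\<^sup>2 * x / 2))) u = ennreal (exp (L r - a * (u - r)))" if "u \<ge> 0" for u
  proof -
    have "c * exp (- a * u) = exp (L r - a * (u - r))"
      by (simp add: c_def mult_exp_exp algebra_simps)
    then show ?thesis using scale_mixture_exp_cmult[OF a _ that, of c] by (simp add: c_def)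
  qed
  show thesis
  proof (rule that[OF a])
    show "c > 0" by (simp add: c_def)
    show "scale_mixture (\<lambda>x. c * a * exp (- (a\<^sup>2 * x / 2))) r = scale_mixture W r"
      using rst by (simp add: val L[OF fin])
    show "scale_mixture (\<lambda>x. c * a * exp (- (a\<^sup>2 * x / 2))) t = scale_mixture W t"
    proof -
      have "L r - a * (t - r) = L t" using rst by (simp add: a_def)
      then show ?thesis using rst val[of t] L[OF fint] by simp
    qed
    have "L r - a * (s - r) = ((t - r) * L r - (L r - L t) * (s - r)) / (t - r)"
      using rst by (simp add: a_def field_simps)
    also have "(t - r) * L r - (L r - L t) * (s - r) = (t - s) * L r + (s - r) * L t"
      by (simp add: algebra_simps)
    finally show "scale_mixture (\<lambda>x. c * a * exp (- (a\<^sup>2 * x / 2))) s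
        = ennreal (exp (((t - s) * L r + (s - r) * L t) / (t - r)))"
      using rst by (simp add: val)
  qed
qed

text \<open>Here \<open>W\<close> takes the lower role in the comparison and the exponential through
  its values at \<open>r\<close> and \<open>t\<close> the upper one. The point 0 is left out, as the
  mixture may be infinite there.\<close>

lemma (in mixing_weight) scale_mixture_log_convex:
  assumes J: "\<And>a c. a > 0 \<Longrightarrow> c > 0 \<Longrightarrow> is_interval {x. 0 < x \<and> W x < c * exp (- (a\<^sup>2 * x / 2))}"
  shows "convex_on {0<..} (\<lambda>u. ln (enn2real (scale_mixture W u)))"
proof (rule convex_on_linorderI)
  fix \<theta> r t :: real
  assume \<theta>: "0 < \<theta>" "\<theta> < 1" and rt: "r \<in> {0<..}" "t \<in> {0<..}" "r < t"
  define s where "s = (1 - \<theta>) * r + \<theta> * t"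
  define L where "L u = ln (enn2real (scale_mixture W u))" for u
  have sr: "s - r = \<theta> * (t - r)" and ts: "t - s = (1 - \<theta>) * (t - r)"
    by (simp_all add: s_def algebra_simps)
  have "0 < s - r" "0 < t - s" unfolding sr ts using rt \<theta> by simp_all
  then have rst: "0 \<le> r" "r < s" "s < t" using rt by simp_all
  have fin: "scale_mixture W u < \<infinity>" if "u > 0" for u
    using that by (intro scale_mixture_finite) simp
  obtain a c where ac: "a > 0" "c > 0"
    "scale_mixture (\<lambda>x. c * a * exp (- (a\<^sup>2 * x / 2))) r = scale_mixture W r"
    "scale_mixture (\<lambda>x. c * a * exp (- (a\<^sup>2 * x / 2))) t = scale_mixture W t"
    "scale_mixture (\<lambda>x. c * a * exp (- (a\<^sup>2 * x / 2))) s = ennreal (exp (((t - s) * L r + (s - r) * L t) / (t - r)))"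
    using log_interpolation[OF rst fin] rt unfolding L_def by auto
  have "scale_mixture W s \<le> scale_mixture (\<lambda>x. c * a * exp (- (a\<^sup>2 * x / 2))) s"
    using ac rt rst J[of a "c * a"] nonneg
    by (intro scale_mixture_compare[of _ _ r s t] fin) auto
  then have "ennreal (enn2real (scale_mixture W s)) \<le> ennreal (exp (((t - s) * L r + (s - r) * L t) / (t - r)))"
    using ac(5) fin[of s] rst by (simp add: less_top[symmetric])
  then have "enn2real (scale_mixture W s) \<le> exp (((t - s) * L r + (s - r) * L t) / (t - r))"
    by (simp add: ennreal_le_iff)
  moreover have "enn2real (scale_mixture W s) > 0"
    using scale_mixture_pos[of s] fin[of s] rst by (simp add: enn2real_positive_iff)
  ultimately have "L s \<le> ((t - s) * L r + (s - r) * L t) / (t - r)"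
    unfolding L_def by (metis ln_exp ln_le_cancel_iff exp_gt_zero)
  also have "\<dots> = ((1 - \<theta>) * L r + \<theta> * L t) * (t - r) / (t - r)"
    unfolding sr ts by (simp add: algebra_simps)
  also have "\<dots> = (1 - \<theta>) * L r + \<theta> * L t" using rt by simp
  finally show "ln (enn2real (scale_mixture W ((1 - \<theta>) *\<^sub>R r + \<theta> *\<^sub>R t)))
      \<le> (1 - \<theta>) * ln (enn2real (scale_mixture W r)) + \<theta> * ln (enn2real (scale_mixture W t))"
    by (simp add: s_def L_def)
qed (auto intro: convex_real_interval)

text \<open>If the mixture were infinite at 0, comparison with \<open>q exp (a (2 - u))\<close>, which agrees with it
  at \<open>u = 2\<close>, would bound it from below by \<open>q exp a\<close> at \<open>u = 1\<close>, for every \<open>a\<close>.\<close>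

lemma (in mixing_weight) scale_mixture_finite_zero:
  assumes J: "\<And>a c. a > 0 \<Longrightarrow> c > 0 \<Longrightarrow> is_interval {x. 0 < x \<and> c * exp (- (a\<^sup>2 * x / 2)) < W x}"
  shows "scale_mixture W 0 < \<infinity>"
proof (rule ccontr)
  assume "\<not> scale_mixture W 0 < \<infinity>"
  then have inf: "scale_mixture W 0 = \<infinity>" by (simp add: less_top[symmetric])
  define p q where "p = enn2real (scale_mixture W 1)" and "q = enn2real (scale_mixture W 2)"
  have fin: "scale_mixture W 1 < \<infinity>" "scale_mixture W 2 < \<infinity>"
    by (intro scale_mixture_finite, simp)+
  have p: "scale_mixture W 1 = ennreal p" and q: "scale_mixture W 2 = ennreal q"
    using fin by (simp_all add: p_def q_def less_top[symmetric])
  have p0: "p > 0" and q0: "q > 0"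
    using scale_mixture_pos[of 1] scale_mixture_pos[of 2] p q by simp_all
  \<comment> \<open>With this \<open>a\<close> the lower bound at 1 is
    \<open>q * exp a >= q * (1 + a) = q + p\<close>, which exceeds the actual value
    \<open>p\<close>.\<close>
  define a c where "a = p / q" and "c = q * exp (2 * a)"
  have a: "a > 0" and c: "c > 0" using p0 q0 by (simp_all add: a_def c_def)
  have "scale_mixture (\<lambda>x. c * a * exp (- (a\<^sup>2 * x / 2))) 1 \<le> scale_mixture W 1"
  proof (rule scale_mixture_compare[of _ _ 0 1 2])
    show "is_interval {x. 0 < x \<and> c * a * exp (- (a\<^sup>2 * x / 2)) < W x}"
      using J[of a "c * a"] a c by simp
    have "c * exp (- a * 2) = q" by (simp add: c_def mult_exp_exp mult.assoc)
    then show "scale_mixture (\<lambda>x. c * a * exp (- (a\<^sup>2 * x / 2))) 2 \<le> scale_mixture W 2"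
      using scale_mixture_exp_cmult[OF a c, of 2] q by simp
  qed (use a c nonneg inf scale_mixture_exp_cmult[OF a c] in auto)
  then have "c * exp (- a) \<le> p"
    using scale_mixture_exp_cmult[OF a c, of 1] p p0 by (simp add: ennreal_le_iff)
  moreover have "c * exp (- a) = q * exp a" by (simp add: c_def mult_exp_exp mult.assoc)
  moreover have "q * (1 + a) \<le> q * exp a" using q0 by (intro mult_left_mono exp_ge_add_one_self) simp
  moreover have "q * (1 + a) = q + p" using q0 by (simp add: a_def field_simps)
  ultimately show False using q0 by linarith
qed

text \<open>The roles are exchanged: the exponential is below. Finiteness at 0 allows 0 as an
  endpoint, which is needed to join the two half-lines later.\<close>

lemma (in mixing_weight) scale_mixture_log_concave:
  assumes J: "\<And>a c. a > 0 \<Longrightarrow> c > 0 \<Longrightarrow> is_interval {x. 0 < x \<and> c * exp (- (a\<^sup>2 * x / 2)) < W x}"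
  shows "concave_on {0..} (\<lambda>u. ln (enn2real (scale_mixture W u)))"
  unfolding concave_on_def
proof (rule convex_on_linorderI)
  fix \<theta> r t :: real
  assume \<theta>: "0 < \<theta>" "\<theta> < 1" and rt: "r \<in> {0..}" "t \<in> {0..}" "r < t"
  define s where "s = (1 - \<theta>) * r + \<theta> * t"
  define L where "L u = ln (enn2real (scale_mixture W u))" for u
  have sr: "s - r = \<theta> * (t - r)" and ts: "t - s = (1 - \<theta>) * (t - r)"
    by (simp_all add: s_def algebra_simps)
  have "0 < s - r" "0 < t - s" unfolding sr ts using rt \<theta> by simp_all
  then have rst: "0 \<le> r" "r < s" "s < t" using rt by simp_all
  have fin: "scale_mixture W u < \<infinity>" for u
    using scale_mixture_finite[of u] scale_mixture_finite_zero[OF J] by (cases "u = 0") auto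
  obtain a c where ac: "a > 0" "c > 0"
    "scale_mixture (\<lambda>x. c * a * exp (- (a\<^sup>2 * x / 2))) r = scale_mixture W r"
    "scale_mixture (\<lambda>x. c * a * exp (- (a\<^sup>2 * x / 2))) t = scale_mixture W t"
    "scale_mixture (\<lambda>x. c * a * exp (- (a\<^sup>2 * x / 2))) s = ennreal (exp (((t - s) * L r + (s - r) * L t) / (t - r)))"
    using log_interpolation[OF rst fin] unfolding L_def by auto
  have "scale_mixture (\<lambda>x. c * a * exp (- (a\<^sup>2 * x / 2))) s \<le> scale_mixture W s"
    using ac rst J[of a "c * a"] nonneg fin[of r] fin[of t]
    by (intro scale_mixture_compare[of _ _ r s t]) auto
  then have "ennreal (exp (((t - s) * L r + (s - r) * L t) / (t - r))) \<le> ennreal (enn2real (scale_mixture W s))"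
    using ac(5) fin[of s] by (simp add: less_top[symmetric])
  then have "exp (((t - s) * L r + (s - r) * L t) / (t - r)) \<le> enn2real (scale_mixture W s)"
    by (simp add: ennreal_le_iff)
  then have "((t - s) * L r + (s - r) * L t) / (t - r) \<le> L s"
    unfolding L_def using scale_mixture_pos[of s] fin[of s]
    by (subst ln_ge_iff) (simp_all add: enn2real_positive_iff)
  moreover have "((t - s) * L r + (s - r) * L t) / (t - r) = ((1 - \<theta>) * L r + \<theta> * L t) * (t - r) / (t - r)"
    unfolding sr ts by (simp add: algebra_simps)
  moreover have "\<dots> = (1 - \<theta>) * L r + \<theta> * L t" using rt by simp
  ultimately show "- ln (enn2real (scale_mixture W ((1 - \<theta>) *\<^sub>R r + \<theta> *\<^sub>R t)))
      \<le> (1 - \<theta>) * - ln (enn2real (scale_mixture W r)) + \<theta> * - ln (enn2real (scale_mixture W t))"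
    by (simp add: s_def L_def)
qed (auto intro: convex_real_interval)

text \<open>Dividing by the tilt turns the crossings of the tilted weight into crossings of the
  weight itself with exponentials whose rate may have either sign.\<close>

lemma tilted_exp_less_iff:
  fixes p q c w x :: real
  shows "c * exp (- (p * x / 2)) < exp (- (q * x / 2)) * w \<longleftrightarrow> c * exp ((q - p) / 2 * x) < w"
    and "exp (- (q * x / 2)) * w < c * exp (- (p * x / 2)) \<longleftrightarrow> w < c * exp ((q - p) / 2 * x)"
proof -
  have e: "exp (- (p * x / 2)) = exp (- (q * x / 2)) * exp ((q - p) / 2 * x)"
    by (simp add: mult_exp_exp diff_divide_distrib left_diff_distrib)
  show "c * exp (- (p * x / 2)) < exp (- (q * x / 2)) * w \<longleftrightarrow> c * exp ((q - p) / 2 * x) < w"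
    unfolding e mult.left_commute[of c] by simp
  show "exp (- (q * x / 2)) * w < c * exp (- (p * x / 2)) \<longleftrightarrow> w < c * exp ((q - p) / 2 * x)"
    unfolding e mult.left_commute[of c] by simp
qed

lemma convex_combination_witness:
  fixes a b x :: real
  assumes "a < x" "x < b"
  obtains \<theta> where "\<theta> \<in> {0<..<1}" "x = \<theta> * a + (1 - \<theta>) * b"
proof -
  define \<theta> where "\<theta> = (b - x) / (b - a)"
  have "\<theta> * (b - a) = b - x" using assms by (simp add: \<theta>_def)
  then have "x = \<theta> * a + (1 - \<theta>) * b" by (simp add: algebra_simps)
  moreover have "\<theta> \<in> {0<..<1}" using assms by (simp add: \<theta>_def divide_less_eq)
  ultimately show thesis by (rule that[rotated])
qed

text \<open>A log-affine function gives equality in the geometric interpolation, so a strict excess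
  over it at both ends survives in between.\<close>

lemma logconcave_interval:
  fixes g :: "real \<Rightarrow> real"
  assumes lc: "logconcave (\<lambda>x. ennreal (g x))" and g: "\<And>x. g x \<ge> 0" and k: "k > 0"
  shows "is_interval {x. 0 < x \<and> k * exp (l * x) < g x}"
  unfolding is_interval_1
proof (intro ballI allI impI)
  fix a b x :: real
  assume ab: "a \<in> {x. 0 < x \<and> k * exp (l * x) < g x}" "b \<in> {x. 0 < x \<and> k * exp (l * x) < g x}"
    and x: "a \<le> x \<and> x \<le> b"
  show "x \<in> {x. 0 < x \<and> k * exp (l * x) < g x}"
  proof (cases "x = a \<or> x = b")
    case True
    with ab show ?thesis by auto
  next
    case False
    then obtain \<theta> where \<theta>: "\<theta> \<in> {0<..<1}" "x = \<theta> * a + (1 - \<theta>) * b"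
      using convex_combination_witness[of a x b] x by force
    have "ennreal_powr (ennreal (g a)) \<theta> * ennreal_powr (ennreal (g b)) (1 - \<theta>) \<le> ennreal (g x)"
      using lc \<theta> unfolding logconcave_def by blast
    then have "ennreal (g a powr \<theta> * g b powr (1 - \<theta>)) \<le> ennreal (g x)"
      using g by (simp add: ennreal_powr_def ennreal_mult)
    then have gx: "g a powr \<theta> * g b powr (1 - \<theta>) \<le> g x" using g by (simp add: ennreal_le_iff)
    have ga: "0 < g a"
      using ab k by (auto intro: less_trans[of 0 "k * exp (l * a)"])
    have "k * exp (l * x) = (k * exp (l * a)) powr \<theta> * (k * exp (l * b)) powr (1 - \<theta>)"
    proof -
      have "k powr \<theta> * k powr (1 - \<theta>) = k" using k by (simp add: powr_add[symmetric])
      moreover have "exp (l * x) = exp (l * a) powr \<theta> * exp (l * b) powr (1 - \<theta>)"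
        unfolding \<theta>(2) by (simp add: powr_def mult_exp_exp algebra_simps)
      ultimately show ?thesis using k by (simp add: powr_mult mult_ac)
    qed
    also have "\<dots> < g a powr \<theta> * g b powr (1 - \<theta>)"
      using ab \<theta> k ga by (intro mult_strict_mono powr_less_mono2) auto
    also note gx
    finally show ?thesis using ab x by simp
  qed
qed

text \<open>After taking logarithms, a convex function lying below a line at two points lies below
  it between them.\<close>

lemma logconvex_interval:
  fixes g :: "real \<Rightarrow> real"
  assumes lc: "logconvex_on {0<..} (\<lambda>x. ennreal (g x))" and g: "\<And>x. g x \<ge> 0" and k: "k > 0"
  shows "is_interval {x. 0 < x \<and> g x < k * exp (l * x)}"
  unfolding is_interval_1
proof (intro ballI allI impI)
  fix a b x :: real
  assume ab: "a \<in> {x. 0 < x \<and> g x < k * exp (l * x)}" "b \<in> {x. 0 < x \<and> g x < k * exp (l * x)}"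
    and x: "a \<le> x \<and> x \<le> b"
  have pos: "g u > 0" if "u > 0" for u
    using lc that by (simp add: logconvex_on_def)
  have iff: "g u < k * exp (l * u) \<longleftrightarrow> ln (g u) < ln k + l * u" if "u > 0" for u
  proof -
    have "g u < k * exp (l * u) \<longleftrightarrow> ln (g u) < ln (k * exp (l * u))"
      using pos[OF that] k by simp
    then show ?thesis using k by (simp add: ln_mult)
  qed
  have conv: "convex_on {0<..} (\<lambda>x. ln (g x))"
    using lc g by (simp add: logconvex_on_def)
  show "x \<in> {x. 0 < x \<and> g x < k * exp (l * x)}"
  proof (cases "x = a \<or> x = b")
    case True
    with ab show ?thesis by auto
  next
    case False
    then obtain \<theta> where \<theta>: "\<theta> \<in> {0<..<1}" "x = \<theta> * a + (1 - \<theta>) * b"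
      using convex_combination_witness[of a x b] x by force
    have "ln (g x) \<le> \<theta> * ln (g a) + (1 - \<theta>) * ln (g b)"
      using convex_onD[OF conv, of "1 - \<theta>" a b] ab \<theta> by simp
    also have "\<dots> < \<theta> * (ln k + l * a) + (1 - \<theta>) * (ln k + l * b)"
      using ab iff[of a] iff[of b] \<theta> by (intro add_strict_mono mult_strict_left_mono) auto
    also have "\<dots> = ln k + l * x" unfolding \<theta>(2) by (simp add: algebra_simps)
    finally show ?thesis using ab x iff[of x] by simp
  qed
qed

lemma logconcave_ennreal_exp:
  fixes h :: "real \<Rightarrow> real"
  assumes "concave_on UNIV h"
  shows "logconcave (\<lambda>y. ennreal (exp (h y)))"
  unfolding logconcave_def
proof (intro allI ballI)
  fix x y \<theta> :: real assume \<theta>: "\<theta> \<in> {0<..<1}"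
  have "ennreal_powr (ennreal (exp (h x))) \<theta> * ennreal_powr (ennreal (exp (h y))) (1 - \<theta>)
      = ennreal (exp (\<theta> * h x + (1 - \<theta>) * h y))"
    by (simp add: ennreal_powr_def ennreal_mult'[symmetric] powr_def mult_exp_exp)
  also have "\<dots> \<le> ennreal (exp (h (\<theta> * x + (1 - \<theta>) * y)))"
    using concave_onD[OF assms, of "1 - \<theta>" x y] \<theta> by (intro ennreal_leI) simp
  finally show "ennreal_powr (ennreal (exp (h x))) \<theta> * ennreal_powr (ennreal (exp (h y))) (1 - \<theta>)
      \<le> ennreal (exp (h (\<theta> * x + (1 - \<theta>) * y)))" .
qed

text \<open>The scale and the drift contribute an affine function to the log-density. The absolute
  value moves the remaining term to the half-line where its concavity or convexity is known.\<close>

lemma (in mixing_weight) mixture_eq_exp: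
  assumes s: "\<sigma> > 0" and fin: "scale_mixture (\<lambda>x. exp (- (b\<^sup>2 * x / 2)) * W x) t < \<infinity>"
  shows "ennreal (1 / \<sigma>) * mixture b W t
    = ennreal (exp (- ln \<sigma> + b * t + ln (enn2real (scale_mixture (\<lambda>x. exp (- (b\<^sup>2 * x / 2)) * W x) \<bar>t\<bar>))))"
proof -
  interpret T: mixing_weight "\<lambda>x. exp (- (b\<^sup>2 * x / 2)) * W x" by (rule mixing_weight_tilt)
  define p where "p = enn2real (scale_mixture (\<lambda>x. exp (- (b\<^sup>2 * x / 2)) * W x) t)"
  have p: "scale_mixture (\<lambda>x. exp (- (b\<^sup>2 * x / 2)) * W x) t = ennreal p"
    using fin by (simp add: p_def less_top[symmetric])
  have p0: "p > 0" using T.scale_mixture_pos[of t] p by simp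
  have "exp (- ln \<sigma> + b * t + ln p) = 1 / \<sigma> * (exp (b * t) * p)"
  proof -
    have "exp (- ln \<sigma>) = inverse \<sigma>" using s by (simp only: exp_minus exp_ln)
    then show ?thesis using p0 by (simp only: exp_add exp_ln) (simp add: divide_inverse)
  qed
  then show ?thesis
    unfolding mixture_def scale_mixture_abs p using s p0
    by (simp add: ennreal_mult'[symmetric])
qed

text \<open>A concave decreasing function composed with the convex function
  \<open>\<bar>t\<bar>\<close> is concave on the whole line, and the affine term does not disturb
  this.\<close>

lemma (in mixing_weight) logconcave_mixture:
  assumes lc: "logconcave (\<lambda>x. ennreal (W x))" and W: "\<And>x. W x \<ge> 0" and s: "\<sigma> > 0"
  shows "logconcave (\<lambda>y. ennreal (1 / \<sigma>) * mixture b W ((y - \<mu>) / \<sigma>))"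
proof -
  interpret T: mixing_weight "\<lambda>x. exp (- (b\<^sup>2 * x / 2)) * W x" by (rule mixing_weight_tilt)
  define L where "L u = ln (enn2real (scale_mixture (\<lambda>x. exp (- (b\<^sup>2 * x / 2)) * W x) u))" for u
  have J: "is_interval {x. 0 < x \<and> c * exp (- (a\<^sup>2 * x / 2)) < exp (- (b\<^sup>2 * x / 2)) * W x}" if "c > 0" for a c
    unfolding tilted_exp_less_iff using that by (intro logconcave_interval[OF lc W])
  have fin: "scale_mixture (\<lambda>x. exp (- (b\<^sup>2 * x / 2)) * W x) t < \<infinity>" for t
    using T.scale_mixture_finite[of t] T.scale_mixture_finite_zero[OF J] by (cases "t = 0") auto
  have L: "concave_on {0..} L"
    unfolding L_def by (rule T.scale_mixture_log_concave[OF J])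
  have mono: "L v \<le> L u" if "0 \<le> u" "u \<le> v" for u v
    unfolding L_def using T.scale_mixture_antimono[OF that] T.scale_mixture_pos fin
    by (intro ln_mono enn2real_mono) (auto simp: enn2real_positive_iff)
  have "concave_on UNIV (\<lambda>y. - ln \<sigma> + b * ((y - \<mu>) / \<sigma>) + L \<bar>(y - \<mu>) / \<sigma>\<bar>)"
    unfolding concave_on_iff
  proof (intro conjI ballI allI impI)
    fix x y u v :: real assume uv: "u \<ge> 0" "v \<ge> 0" "u + v = 1"
    define x' y' where "x' = (x - \<mu>) / \<sigma>" and "y' = (y - \<mu>) / \<sigma>"
    have v: "v = 1 - u" using uv by simp
    have eq: "(u *\<^sub>R x + v *\<^sub>R y - \<mu>) / \<sigma> = u * x' + v * y'"
      using s unfolding v x'_def y'_def by (simp add: field_simps)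
    have "u * L \<bar>x'\<bar> + v * L \<bar>y'\<bar> \<le> L (u * \<bar>x'\<bar> + v * \<bar>y'\<bar>)"
      using L uv by (auto simp: concave_on_iff)
    \<comment> \<open>The triangle inequality together with the fact that \<open>L\<close>
      decreases.\<close>
    also have "\<dots> \<le> L \<bar>u * x' + v * y'\<bar>"
      using uv abs_triangle_ineq[of "u * x'" "v * y'"] by (intro mono) (auto simp: abs_mult)
    finally have "u * L \<bar>x'\<bar> + v * L \<bar>y'\<bar> \<le> L \<bar>u * x' + v * y'\<bar>" .
    moreover have "u * (- ln \<sigma> + b * x' + L \<bar>x'\<bar>) + v * (- ln \<sigma> + b * y' + L \<bar>y'\<bar>)
      = (- ln \<sigma> + b * (u * x' + v * y')) + (u * L \<bar>x'\<bar> + v * L \<bar>y'\<bar>)"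
      unfolding v by (simp add: algebra_simps)
    ultimately show "- ln \<sigma> + b * ((u *\<^sub>R x + v *\<^sub>R y - \<mu>) / \<sigma>) + L \<bar>(u *\<^sub>R x + v *\<^sub>R y - \<mu>) / \<sigma>\<bar>
      \<ge> u * (- ln \<sigma> + b * ((x - \<mu>) / \<sigma>) + L \<bar>(x - \<mu>) / \<sigma>\<bar>) + v * (- ln \<sigma> + b * ((y - \<mu>) / \<sigma>) + L \<bar>(y - \<mu>) / \<sigma>\<bar>)"
      unfolding eq x'_def[symmetric] y'_def[symmetric] by simp
  qed simp
  then show ?thesis
    unfolding mixture_eq_exp[OF s fin] L_def by (rule logconcave_ennreal_exp)
qed

text \<open>On one side of \<open>\<mu>\<close> the absolute value is linear, so convexity of
  \<open>L\<close> carries over; both points have to lie on the same side.\<close>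

lemma (in mixing_weight) logconvex_on_mixture:
  assumes lc: "logconvex_on {0<..} (\<lambda>x. ennreal (W x))" and W: "\<And>x. W x \<ge> 0" and s: "\<sigma> > 0"
    and I: "convex I" "I \<subseteq> {..<\<mu>} \<or> I \<subseteq> {\<mu><..}"
  shows "logconvex_on I (\<lambda>y. ennreal (1 / \<sigma>) * mixture b W ((y - \<mu>) / \<sigma>))"
proof -
  interpret T: mixing_weight "\<lambda>x. exp (- (b\<^sup>2 * x / 2)) * W x" by (rule mixing_weight_tilt)
  define L where "L u = ln (enn2real (scale_mixture (\<lambda>x. exp (- (b\<^sup>2 * x / 2)) * W x) u))" for u
  define h where "h y = - ln \<sigma> + b * ((y - \<mu>) / \<sigma>) + L \<bar>(y - \<mu>) / \<sigma>\<bar>" for y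
  have J: "is_interval {x. 0 < x \<and> exp (- (b\<^sup>2 * x / 2)) * W x < c * exp (- (a\<^sup>2 * x / 2))}" if "c > 0" for a c
    unfolding tilted_exp_less_iff using that by (intro logconvex_interval[OF lc W])
  have L: "convex_on {0<..} L"
    unfolding L_def by (rule T.scale_mixture_log_convex[OF J])
  have eq: "ennreal (1 / \<sigma>) * mixture b W ((y - \<mu>) / \<sigma>) = ennreal (exp (h y))" if "y \<in> I" for y
    unfolding h_def L_def using that I s by (intro mixture_eq_exp T.scale_mixture_finite) auto
  have "convex_on I h"
    unfolding convex_on_def
  proof (intro conjI ballI allI impI)
    fix x y u v :: real assume xy: "x \<in> I" "y \<in> I" and uv: "u \<ge> 0" "v \<ge> 0" "u + v = 1"
    define x' y' where "x' = (x - \<mu>) / \<sigma>" and "y' = (y - \<mu>) / \<sigma>"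
    have v: "v = 1 - u" using uv by simp
    have e: "(u *\<^sub>R x + v *\<^sub>R y - \<mu>) / \<sigma> = u * x' + v * y'"
      using s unfolding v x'_def y'_def by (simp add: field_simps)
    have sgn: "(x' < 0 \<and> y' < 0) \<or> (x' > 0 \<and> y' > 0)"
      using xy I s by (auto simp: x'_def y'_def divide_less_0_iff)
    then have "\<bar>u * x' + v * y'\<bar> = u * \<bar>x'\<bar> + v * \<bar>y'\<bar>"
    proof
      assume n: "x' < 0 \<and> y' < 0"
      then have "u * x' \<le> 0" "v * y' \<le> 0" using uv by (simp_all add: mult_nonneg_nonpos)
      with n show ?thesis by simp
    next
      assume n: "x' > 0 \<and> y' > 0"
      then have "u * x' \<ge> 0" "v * y' \<ge> 0" using uv by simp_all
      with n show ?thesis by simp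
    qed
    moreover have "L (u * \<bar>x'\<bar> + v * \<bar>y'\<bar>) \<le> u * L \<bar>x'\<bar> + v * L \<bar>y'\<bar>"
    proof -
      have "\<bar>x'\<bar> \<in> {0<..}" "\<bar>y'\<bar> \<in> {0<..}" using sgn by auto
      from convex_onD[OF L _ _ this, of v] uv show ?thesis by (simp add: v)
    qed
    moreover have "u * (- ln \<sigma> + b * x' + L \<bar>x'\<bar>) + v * (- ln \<sigma> + b * y' + L \<bar>y'\<bar>)
      = (- ln \<sigma> + b * (u * x' + v * y')) + (u * L \<bar>x'\<bar> + v * L \<bar>y'\<bar>)"
      unfolding v by (simp add: algebra_simps)
    ultimately show "h (u *\<^sub>R x + v *\<^sub>R y) \<le> u * h x + v * h y"
      unfolding h_def e x'_def[symmetric] y'_def[symmetric] by simp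
  qed (rule I)
  then have "convex_on I (\<lambda>y. ln (enn2real (ennreal (1 / \<sigma>) * mixture b W ((y - \<mu>) / \<sigma>))))"
    unfolding convex_on_def using convexD[OF I(1)] by (simp add: eq)
  then show ?thesis
    unfolding logconvex_on_def by (simp add: eq)
qed

subsection \<open>Total mass of the densities\<close>

lemma distributed_nn_integral:
  assumes M: "prob_space M" and X: "distributed M N X f"
  shows "(\<integral>\<^sup>+x. f x \<partial>N) = 1"
proof -
  interpret D: prob_space "distr M N X"
    by (rule prob_space.prob_space_distr[OF M distributed_measurable[OF X]])
  have "prob_space (density N f)"
    using D.prob_space_axioms distributed_distr_eq_density[OF X] by simp
  then have "emeasure (density N f) (space N) = 1"
    using prob_space.emeasure_space_1 by fastforce
  then show ?thesis
    using distributed_borel_measurable[OF X] by (simp add: emeasure_density cong: nn_integral_cong)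
qed

lemma mixing_weight_of_density:
  assumes M: "prob_space M" and g: "\<And>x. g x \<ge> 0" and g0: "\<And>x. x \<le> 0 \<Longrightarrow> g x = 0"
    and X: "distributed M lborel X (\<lambda>x. ennreal (g x))"
  shows "mixing_weight g"
proof
  have "(\<lambda>x. enn2real (ennreal (g x))) \<in> borel_measurable borel"
    using distributed_borel_measurable[OF X] by measurable
  then show meas: "g \<in> borel_measurable borel" by (simp add: g)
  have "(\<integral>\<^sup>+x\<in>{0<..}. ennreal (g x) \<partial>lborel) = (\<integral>\<^sup>+x. ennreal (g x) \<partial>lborel)"
    by (intro nn_integral_cong) (auto simp: indicator_def g0)
  also have "\<dots> = 1"
    by (rule distributed_nn_integral[OF M X])
  finally have mass: "(\<integral>\<^sup>+x\<in>{0<..}. ennreal (g x) \<partial>lborel) = 1" .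
  then show "(\<integral>\<^sup>+x\<in>{0<..}. ennreal (g x) \<partial>lborel) < \<infinity>" by simp
  show "\<not> (AE x in lborel. x > 0 \<longrightarrow> g x = 0)"
  proof
    assume "AE x in lborel. x > 0 \<longrightarrow> g x = 0"
    then have "AE x in lborel. ennreal (g x) * indicator {0<..} x = 0"
      by eventually_elim (auto simp: indicator_def)
    then have "(\<integral>\<^sup>+x\<in>{0<..}. ennreal (g x) \<partial>lborel) = 0"
      using distributed_borel_measurable[OF X] by (subst nn_integral_0_iff_AE) simp_all
    with mass show False by simp
  qed
qed (rule g)

text \<open>Each half-line has infinite measure, so a density of total mass 1 cannot stay above a
  positive value on it. This also covers \<open>f a = \<infinity>\<close>.\<close>

lemma distributed_density_less:
  fixes Y :: "'a \<Rightarrow> real"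
  assumes M: "prob_space M" and Y: "distributed M lborel Y f" and pos: "0 < f a"
  shows "\<exists>y>a. f y < f a" "\<exists>y<a. f y < f a"
proof -
  have mass: "(\<integral>\<^sup>+y. f y \<partial>lborel) = 1"
    by (rule distributed_nn_integral[OF M Y])
  have *: "\<exists>y\<in>S. f y < f a" if S: "S \<in> sets borel" "emeasure lborel S = \<infinity>" for S
  proof (rule ccontr)
    assume "\<not> (\<exists>y\<in>S. f y < f a)"
    then have "(\<integral>\<^sup>+y. f a * indicator S y \<partial>lborel) \<le> (\<integral>\<^sup>+y. f y \<partial>lborel)"
      by (intro nn_integral_mono) (auto simp: indicator_def not_less)
    moreover have "(\<integral>\<^sup>+y. f a * indicator S y \<partial>lborel) = \<infinity>"
      using S pos by (simp add: nn_integral_cmult_indicator ennreal_mult_top)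
    ultimately show False using mass by (simp add: top_unique)
  qed
  show "\<exists>y>a. f y < f a"
    using *[of "{a<..}"] by (auto simp: emeasure_lborel_Ioi)
  have "emeasure lborel {..<a} = emeasure (distr lborel borel uminus) {..<a}"
    by (simp add: lborel_distr_uminus)
  also have "\<dots> = emeasure lborel {- a<..}"
    by (subst emeasure_distr) (auto intro!: arg_cong[where f = "emeasure lborel"])
  finally show "\<exists>y<a. f y < f a"
    using *[of "{..<a}"] by (auto simp: emeasure_lborel_Ioi)
qed

theorem theorem1:
  fixes M :: "'a measure" and X Y Z :: "'a \<Rightarrow> real"
    and \<mu> \<beta> \<sigma> :: real and g :: "real \<Rightarrow> real" and f :: "real \<Rightarrow> ennreal"
  assumes "prob_space M"
    and "\<sigma> > 0"
    and g_nonneg: "\<And>x. g x \<ge> 0"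
    and g_support: "\<And>x. x \<le> 0 \<Longrightarrow> g x = 0"
    and X_density: "distributed M lborel X (\<lambda>x. ennreal (g x))"
    and Z_normal: "distributed M lborel Z (\<lambda>z. ennreal (std_normal_density z))"
    and indep: "prob_space.indep_var M borel X borel Z"
    and Y_eq: "Y = (\<lambda>\<omega>. \<mu> + \<beta> * X \<omega> + \<sigma> * sqrt (X \<omega>) * Z \<omega>)"
    and f_eq: "f = mixture_density \<mu> \<beta> \<sigma> g"
  shows "distributed M lborel Y f
    \<and> (unimodal_pos g \<longrightarrow> unimodal f)
    \<and> (antimono_on {0<..} g \<or> \<beta> = 0 \<longrightarrow> (\<forall>m. is_mode f m \<longleftrightarrow> m = \<mu>))
    \<and> (logconcave (\<lambda>x. ennreal (g x)) \<longrightarrow> logconcave f)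
    \<and> (logconvex_on {0<..} (\<lambda>x. ennreal (g x)) \<longrightarrow>
         logconvex_on {..<\<mu>} f \<and> logconvex_on {\<mu><..} f)"
proof -
  interpret mixing_weight g
    by (rule mixing_weight_of_density[OF assms(1) g_nonneg g_support X_density])
  define b where "b = \<beta> / \<sigma>"
  have f: "f y = ennreal (1 / \<sigma>) * mixture b g ((y - \<mu>) / \<sigma>)" for y
    unfolding f_eq b_def by (rule mixture_density_eq[OF assms(2) meas g_nonneg])
  have f_less: "mixture b g ((x - \<mu>) / \<sigma>) < mixture b g ((y - \<mu>) / \<sigma>) \<longleftrightarrow> f x < f y" for x y
    using assms(2) unfolding f by (simp add: not_le[symmetric] ennreal_mult_le_mult_iff)
  have mode: "is_mode f m \<longleftrightarrow> is_mode (mixture b g) ((m - \<mu>) / \<sigma>)" for m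
    using assms(2) f by (rule is_mode_affine)
  have dist: "distributed M lborel Y f"
    unfolding Y_eq f_eq
    by (rule distributed_mixture_density[OF assms(1-2) g_nonneg g_support X_density Z_normal indep meas])
  have ii: "is_mode f m \<longleftrightarrow> m = \<mu>" if "antimono_on {0<..} g \<or> \<beta> = 0" for m
    using is_mode_mixture_iff[of b "(m - \<mu>) / \<sigma>"] that assms(2) by (auto simp: mode b_def)
  have i: "unimodal f" if uni: "unimodal_pos g"
  proof -
    have "f \<mu> > 0"
      unfolding f using assms(2) mixture_pos by (simp add: ennreal_zero_less_mult_iff)
    \<comment> \<open>A point below \<open>f \<mu>\<close> on each side of \<open>\<mu>\<close>; the
      sign of \<open>b\<close> decides which one bounds the search for a maximum.\<close>
    note dec = distributed_density_less[OF assms(1) dist this]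
    have "\<exists>m. is_mode (mixture b g) m"
    proof -
      consider "b = 0" | "b > 0" | "b < 0" by linarith
      then show ?thesis
      proof cases
        case 1
        then show ?thesis using is_mode_mixture_iff[of b] by blast
      next
        case 2
        obtain y where y: "y > \<mu>" "f y < f \<mu>" using dec(1) by blast
        have "unimodal (mixture b g)"
        proof (rule mixture_unimodal_pos_drift[OF 2 uni])
          show "(y - \<mu>) / \<sigma> > 0" using y assms(2) by simp
          show "mixture b g ((y - \<mu>) / \<sigma>) < mixture b g 0"
            using y f_less[of y \<mu>] by simp
        qed
        then show ?thesis by (simp add: unimodal_def)
      next
        case 3
        \<comment> \<open>Reflection turns a point left of \<open>\<mu>\<close> into the positive
          argument wanted for the drift \<open>- b\<close>.\<close>
        obtain y where y: "y < \<mu>" "f y < f \<mu>" using dec(2) by blast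
        have "unimodal (mixture (- b) g)"
        proof (rule mixture_unimodal_pos_drift[OF _ uni])
          show "- b > 0" using 3 by simp
          show "- ((y - \<mu>) / \<sigma>) > 0" using y assms(2) by (simp add: divide_less_0_iff)
          show "mixture (- b) g (- ((y - \<mu>) / \<sigma>)) < mixture (- b) g 0"
            unfolding mixture_uminus using y f_less[of y \<mu>] mixture_uminus[of b g 0] by simp
        qed
        then obtain m where "is_mode (\<lambda>t. mixture b g (- t)) m"
          by (auto simp: unimodal_def mixture_uminus[abs_def])
        then show ?thesis unfolding is_mode_uminus by blast
      qed
    qed
    then obtain m where "is_mode (mixture b g) m" by blast
    then have "is_mode f (\<mu> + \<sigma> * m)" using assms(2) by (simp add: mode)
    then show ?thesis by (auto simp: unimodal_def)
  qed
  have iii: "logconcave f" if "logconcave (\<lambda>x. ennreal (g x))"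
    using logconcave_mixture[OF that g_nonneg assms(2), of b \<mu>] by (simp add: f[abs_def])
  have iv: "logconvex_on I f" if "logconvex_on {0<..} (\<lambda>x. ennreal (g x))"
    "convex I" "I \<subseteq> {..<\<mu>} \<or> I \<subseteq> {\<mu><..}" for I
    using logconvex_on_mixture[OF that(1) g_nonneg assms(2) that(2,3), of b] by (simp add: f[abs_def])
  show ?thesis
    using dist i ii iii iv[of "{..<\<mu>}"] iv[of "{\<mu><..}"] by (auto intro: convex_real_interval)
qed

end
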